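(* Fix an integer $d\ge 1$ and let $L(G_n)$ be the number of leaves (vertices of degree $1$) of the $d$-NN tree $G_n$. Then there is a deterministic sequence $\varepsilon_n\to 0$ such that, with probability tending to $1$ as $n\to\infty$, $$\left(\frac{1}{4e^4}-\varepsilon_n\right)n\le L(G_n)\le\left(\frac12+\varepsilon_n\right)n.$$
   Context: Let $\mathbb T^d_n$ be the $d$-dimensional torus of volume $n$ (that is, $\mathbb R^d/(n^{1/d}\mathbb Z)^d$) with the metric inherited from the Euclidean metric. The $d$-NN tree $G_n$: vertices $0,1,\dots,n-1$ arrive one by one, vertex $i$ being placed at a uniformly random point of $\mathbb T^d_n$, independently of all others; each vertex $i\ge 1$ is connected upon arrival by an edge to the closest vertex among $\{0,\dots,i-1\}$ in the torus metric (ties have probability $0$). *)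

theory Defs
  imports "HOL-Probability.Probability"
begin

text \<open>
  The dimension \<open>d \<ge> 1\<close> is \<open>CARD('d)\<close>. A point of the torus
  \<open>\<real>\<^sup>d / (n\<^bsup>1/d\<^esup> \<int>)\<^sup>d\<close> is given by a representative in \<open>\<real>\<^sup>d\<close>:
  \<open>torus_dist\<close> is the quotient metric, the distance between the two cosets of the
  lattice, and a uniform point of the torus has a representative that is uniform on the
  fundamental domain \<open>[0, n\<^bsup>1/d\<^esup>)\<^sup>d\<close>.
\<close>

definition torus_dist :: "nat \<Rightarrow> real^'d \<Rightarrow> real^'d \<Rightarrow> real" where
  "torus_dist n x y =
     (INF k::int^'d. dist x (y + root CARD('d) (real n) *\<^sub>R (\<chi> i. of_int (k $ i))))"

definition fundamental_domain :: "nat \<Rightarrow> (real^'d) set" where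
  "fundamental_domain n = {x. \<forall>i. 0 \<le> x $ i \<and> x $ i < root CARD('d) (real n)}"

definition nn_space :: "nat \<Rightarrow> (nat \<Rightarrow> real^'d) measure" where
  "nn_space n = PiM {..<n} (\<lambda>_. uniform_measure lborel (fundamental_domain n))"

text \<open>Ties, which have probability \<open>0\<close>, are broken in favour of the oldest vertex.\<close>

definition nn_parent :: "nat \<Rightarrow> (nat \<Rightarrow> real^'d) \<Rightarrow> nat \<Rightarrow> nat" where
  "nn_parent n x i =
     (LEAST j. j < i \<and> (\<forall>k<i. torus_dist n (x i) (x j) \<le> torus_dist n (x i) (x k)))"

definition nn_edges :: "nat \<Rightarrow> (nat \<Rightarrow> real^'d) \<Rightarrow> nat set set" where
  "nn_edges n x = {{i, nn_parent n x i} | i. 1 \<le> i \<and> i < n}"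

definition nn_degree :: "nat \<Rightarrow> (nat \<Rightarrow> real^'d) \<Rightarrow> nat \<Rightarrow> nat" where
  "nn_degree n x v = card {e \<in> nn_edges n x. v \<in> e}"

definition nn_leaves :: "nat \<Rightarrow> (nat \<Rightarrow> real^'d) \<Rightarrow> nat" where
  "nn_leaves n x = card {v \<in> {..<n}. nn_degree n x v = 1}"

end

theory Submission
  imports Defs "HOL-Real_Asymp.Real_Asymp"
begin

text \<open>
  Up to an error of \<open>1\<close>, the number of leaves is the number \<open>F\<close> of vertices without children.

  Upper bound on the mean of \<open>F\<close>. Let \<open>j\<close> attach to \<open>i\<close>. A reflection in the bisector of the two points
  shows that \<open>i\<close> is at most as likely as \<open>j\<close> to receive a child after time \<open>j\<close>. Hence \<open>j\<close> is the
  last child of \<open>i\<close> with at least the probability that \<open>j\<close> itself remains childless. Summation over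
  \<open>j\<close> shows that on average there are at least as many vertices with children as without. Only
  edges shorter than an eighth of the side of the torus are considered, since a reflection is not a
  symmetry of the torus; long edges are exponentially unlikely.

  Lower bound on the mean of \<open>F\<close>. By exchangeability \<open>k\<close> attaches to \<open>i\<close> with probability at most
  \<open>1 / (i + 1)\<close>, so that few of the last \<open>n / 4\<close> vertices have children.

  Concentration. Moving the point \<open>i\<close> changes \<open>F\<close> by at most one plus the numbers of children of \<open>i\<close>
  before and after the move. Two given vertices rarely share a parent, so that the
  squared numbers of children have total mean \<open>o(n\<^sup>2)\<close>, and the Efron--Stein inequality bounds the variance
  of \<open>F\<close> by \<open>o(n\<^sup>2)\<close>.
\<close>

subsection \<open>Product measures\<close>

text \<open>The reflection must preserve the law of the older vertices without bringing any of them
  nearer to a later child of \<open>i\<close>. Both hold if only the two lunes are exchanged, the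
  symmetric difference of the balls around \<open>i\<close> and \<open>j\<close> that pass through
  the other point: then the elders of \<open>j\<close> that move all cross the bisector from the
  side of \<open>i\<close> to that of \<open>j\<close>. With edges below an eighth of the side, the
  distances in question stay below half the side, where the torus metric is Euclidean.

  Bounded differences are useless for the concentration, since one vertex can have
  \<open>n - 1\<close> children; Efron--Stein needs only second moments. If \<open>j < k\<close>
  share the parent \<open>i\<close>, then either \<open>j\<close> lies in a small ball around
  \<open>i\<close>, independently of whether \<open>k\<close> prefers \<open>i\<close> to the elders
  of \<open>i\<close>, or the elders of \<open>j\<close> all avoid a ball of that radius around
  \<open>j\<close>. A ball of probability n^(-1/2) gives variance of order at most n^(3/2) ln n.

  The lower bound on the mean comes out as n/6 up to a constant, well above n/(4e^4).\<close>

lemma fun_upd_measurable [measurable (raw)]: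
  assumes "i \<in> I" "f \<in> measurable N (PiM I M)" "g \<in> measurable N (M i)"
  shows "(\<lambda>x. (f x)(i := g x)) \<in> measurable N (PiM I M)"
  by (rule measurable_fun_upd[where J=I]) (use assms in auto)

text \<open>By Fubini it is enough that, with the other coordinates frozen, \<open>T\<close>
  preserves the law of coordinate \<open>i\<close>. \<open>T\<close> may depend on the whole
  configuration, as a reflection determined by two other points does.\<close>

lemma distr_PiM_update:
  assumes M: "\<And>j. prob_space (M j)" and I: "finite I" "i \<in> I"
    and T [measurable]: "T \<in> measurable (PiM I M) (M i)"
    and pres: "\<And>X. X \<in> space (PiM I M) \<Longrightarrow> distr (M i) (M i) (\<lambda>y. T (X(i := y))) = M i"
  shows "distr (PiM I M) (PiM I M) (\<lambda>X. X(i := T X)) = PiM I M"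
proof -
  interpret product_prob_space M
    by (intro product_prob_spaceI M)
  have Im [measurable]: "(\<lambda>X. X(i := T X)) \<in> measurable (PiM I M) (PiM I M)"
    by (rule fun_upd_measurable) (use I in auto)
  define J where "J = I - {i}"
  have J: "finite J" "i \<notin> J" "insert i J = I"
    using I by (auto simp: J_def)
  show ?thesis
  proof (rule measure_eqI)
    fix A assume "A \<in> sets (distr (PiM I M) (PiM I M) (\<lambda>X. X(i := T X)))"
    then have A [measurable]: "A \<in> sets (PiM I M)" by simp
    have "emeasure (distr (PiM I M) (PiM I M) (\<lambda>X. X(i := T X))) A = (\<integral>\<^sup>+X. indicator A X \<partial>distr (PiM I M) (PiM I M) (\<lambda>X. X(i := T X)))"
      by (rule nn_integral_indicator[symmetric]) simp
    also have "\<dots> = (\<integral>\<^sup>+X. indicator A (X(i := T X)) \<partial>PiM I M)"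
      by (rule nn_integral_distr) measurable
    also have "\<dots> = (\<integral>\<^sup>+X. \<integral>\<^sup>+y. indicator A ((X(i := y))(i := T (X(i := y)))) \<partial>M i \<partial>PiM J M)"
      using product_nn_integral_insert[OF J(1,2), of "\<lambda>X. indicator A (X(i := T X))"] J(3) by simp
    also have "\<dots> = (\<integral>\<^sup>+X. \<integral>\<^sup>+y. indicator A (X(i := y)) \<partial>M i \<partial>PiM J M)"
    proof (rule nn_integral_cong)
      fix X assume X: "X \<in> space (PiM J M)"
      have u: "(\<lambda>y. X(i := y)) \<in> measurable (M i) (PiM I M)"
        using X J by (intro measurable_fun_upd[where J=J]) auto
      obtain y0 where "y0 \<in> space (M i)"
        using prob_space.not_empty[OF M] by blast
      with u have X0: "X(i := y0) \<in> space (PiM I M)"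
        by (rule measurable_space)
      have u2: "(\<lambda>y. T (X(i := y))) \<in> measurable (M i) (M i)"
        using u T by (rule measurable_compose)
      have "(\<integral>\<^sup>+y. indicator A (X(i := y)) \<partial>M i) = (\<integral>\<^sup>+y. indicator A (X(i := y)) \<partial>distr (M i) (M i) (\<lambda>y. T (X(i := y))))"
        using pres[OF X0] by simp
      also have "\<dots> = (\<integral>\<^sup>+y. indicator A (X(i := T (X(i := y)))) \<partial>M i)"
        using u2 measurable_compose[OF u, of "indicator A" "borel :: ennreal measure"] by (intro nn_integral_distr) auto
      finally show "(\<integral>\<^sup>+y. indicator A ((X(i := y))(i := T (X(i := y)))) \<partial>M i) = (\<integral>\<^sup>+y. indicator A (X(i := y)) \<partial>M i)"
        by simp
    qed
    also have "\<dots> = (\<integral>\<^sup>+X. indicator A X \<partial>PiM I M)"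
      using product_nn_integral_insert[OF J(1,2), of "indicator A"] J(3) by simp
    also have "\<dots> = emeasure (PiM I M) A"
      by simp
    finally show "emeasure (distr (PiM I M) (PiM I M) (\<lambda>X. X(i := T X))) A = emeasure (PiM I M) A" .
  qed simp
qed

text \<open>The other coordinates decide \<open>P\<close>, and given them \<open>Q\<close> has
  probability at most \<open>q\<close>. In this form an independence argument amounts to integrating
  out one coordinate, with no conditional expectations.\<close>

lemma prob_PiM_conj_le:
  assumes M: "\<And>j. prob_space (M j)" and I: "finite I" "i \<in> I" and "q \<ge> 0"
    and P [measurable]: "Measurable.pred (PiM I M) P" and Q [measurable]: "Measurable.pred (PiM I M) Q"
    and indep: "\<And>X y. X \<in> space (PiM I M) \<Longrightarrow> y \<in> space (M i) \<Longrightarrow> P (X(i := y)) = P X"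
    and bound: "\<And>X. X \<in> space (PiM I M) \<Longrightarrow> P X \<Longrightarrow> measure (M i) {y \<in> space (M i). Q (X(i := y))} \<le> q"
  shows "measure (PiM I M) {X \<in> space (PiM I M). P X \<and> Q X} \<le> q * measure (PiM I M) {X \<in> space (PiM I M). P X}"
proof -
  interpret product_prob_space M
    by (intro product_prob_spaceI M)
  interpret P: prob_space "PiM I M"
    by (intro prob_space_PiM M)
  define J where "J = I - {i}"
  have J: "finite J" "i \<notin> J" "insert i J = I"
    using I by (auto simp: J_def)
  let ?S = "{X \<in> space (PiM I M). P X \<and> Q X}" and ?T = "{X \<in> space (PiM I M). P X}"
  have "emeasure (PiM I M) ?S = (\<integral>\<^sup>+X. indicator ?S X \<partial>PiM I M)"
    by simp
  also have "\<dots> = (\<integral>\<^sup>+X. \<integral>\<^sup>+y. indicator ?S (X(i := y)) \<partial>M i \<partial>PiM J M)"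
    using product_nn_integral_insert[OF J(1,2), of "indicator ?S"] J(3) by simp
  also have "\<dots> \<le> (\<integral>\<^sup>+X. \<integral>\<^sup>+y. ennreal q * indicator ?T (X(i := y)) \<partial>M i \<partial>PiM J M)"
  proof (rule nn_integral_mono)
    fix X assume X: "X \<in> space (PiM J M)"
    have u [measurable]: "(\<lambda>y. X(i := y)) \<in> measurable (M i) (PiM I M)"
      using X J by (intro measurable_fun_upd[where J=J]) auto
    then have sp: "X(i := y) \<in> space (PiM I M)" if "y \<in> space (M i)" for y
      using that by (rule measurable_space)
    obtain y0 where y0: "y0 \<in> space (M i)"
      using prob_space.not_empty[OF M] by blast
    have P_const: "P (X(i := y)) = P (X(i := y0))" if "y \<in> space (M i)" for y
      using indep[OF sp[OF y0] that] by simp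
    show "(\<integral>\<^sup>+y. indicator ?S (X(i := y)) \<partial>M i) \<le> (\<integral>\<^sup>+y. ennreal q * indicator ?T (X(i := y)) \<partial>M i)"
    proof (cases "P (X(i := y0))")
      case True
      have Qm: "{y \<in> space (M i). Q (X(i := y))} \<in> sets (M i)"
        by measurable
      have "(\<integral>\<^sup>+y. indicator ?S (X(i := y)) \<partial>M i) = (\<integral>\<^sup>+y. indicator {y \<in> space (M i). Q (X(i := y))} y \<partial>M i)"
        using True P_const sp by (intro nn_integral_cong) (auto simp: indicator_def)
      also have "\<dots> = ennreal (measure (M i) {y \<in> space (M i). Q (X(i := y))})"
        using Qm by (simp add: finite_measure.emeasure_eq_measure[OF prob_space.finite_measure[OF M]])
      also have "\<dots> \<le> ennreal q"
        using bound[OF sp[OF y0] True] by (simp add: ennreal_leI)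
      also have "ennreal q = (\<integral>\<^sup>+y. ennreal q \<partial>M i)"
        by (simp add: prob_space.emeasure_space_1[OF M])
      also have "\<dots> = (\<integral>\<^sup>+y. ennreal q * indicator ?T (X(i := y)) \<partial>M i)"
        using True P_const sp by (intro nn_integral_cong) (auto simp: indicator_def)
      finally show ?thesis .
    next
      case False
      then have "(\<integral>\<^sup>+y. indicator ?S (X(i := y)) \<partial>M i) = (\<integral>\<^sup>+y. 0 \<partial>M i)"
        using P_const by (intro nn_integral_cong) (auto simp: indicator_def)
      then show ?thesis by simp
    qed
  qed
  also have "\<dots> = (\<integral>\<^sup>+X. ennreal q * indicator ?T X \<partial>PiM I M)"
    using product_nn_integral_insert[OF J(1,2), of "\<lambda>X. ennreal q * indicator ?T X"] J(3) by simp
  also have "\<dots> = ennreal q * emeasure (PiM I M) ?T"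
    by (subst nn_integral_cmult) auto
  finally have "ennreal (measure (PiM I M) ?S) \<le> ennreal (q * measure (PiM I M) ?T)"
    using \<open>q \<ge> 0\<close> by (simp add: P.emeasure_eq_measure ennreal_mult)
  then show ?thesis
    using \<open>q \<ge> 0\<close> by (simp add: ennreal_le_iff)
qed

lemma distr_PiM_permute:
  assumes "prob_space N" "\<pi> permutes I"
  shows "distr (PiM I (\<lambda>_. N)) (PiM I (\<lambda>_. N)) (\<lambda>X. \<lambda>n\<in>I. X (\<pi> n)) = PiM I (\<lambda>_. N)"
  using distr_PiM_reindex[of I "\<lambda>_. N" \<pi> I] assms permutes_inj_on[OF assms(2)] permutes_in_image[OF assms(2)] by auto

text \<open>The new coordinate is integrated last, so that the induction for the Efron--Stein
  inequality can apply its hypothesis to the inner integral at a fixed value of it.\<close>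

lemma integral_PiM_insert_swap:
  fixes f :: "_ \<Rightarrow> real"
  assumes M: "\<And>j. prob_space (M j)" and I: "finite I" "i \<notin> I"
    and f [measurable]: "f \<in> borel_measurable (PiM (insert i I) M)" and b: "\<And>X. \<bar>f X\<bar> \<le> B"
  shows "(\<integral>X. f X \<partial>PiM (insert i I) M) = (\<integral>y. \<integral>X. f (X(i := y)) \<partial>PiM I M \<partial>M i)"
proof -
  interpret product_prob_space M "insert i I"
    by (intro product_prob_spaceI M)
  interpret I0: prob_space "PiM I M" by (intro prob_space_PiM M)
  interpret N: prob_space "M i" by (rule M)
  interpret IM: pair_prob_space "PiM I M" "M i" ..
  have [measurable]: "(\<lambda>(X, y). f (X(i := y))) \<in> borel_measurable (PiM I M \<Otimes>\<^sub>M M i)"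
    using measurable_compose[OF measurable_add_dim f] by (simp add: case_prod_unfold)
  have "(\<integral>X. f X \<partial>PiM (insert i I) M) = (\<integral>X. \<integral>y. f (X(i := y)) \<partial>M i \<partial>PiM I M)"
    using b by (intro product_integral_insert I P.integrable_const_bound[where B=B]) auto
  also have "\<dots> = (\<integral>y. \<integral>X. f (X(i := y)) \<partial>PiM I M \<partial>M i)"
    using b by (intro IM.Fubini_integral[symmetric] IM.integrable_const_bound[where B=B]) auto
  finally show ?thesis .
qed

section \<open>Variance and the Efron--Stein inequality\<close>

lemma (in prob_space) square_expectation_le:
  fixes f :: "'a \<Rightarrow> real"
  assumes [measurable]: "f \<in> borel_measurable M" and b: "\<And>x. \<bar>f x\<bar> \<le> B"
  shows "(\<integral>x. f x \<partial>M)\<^sup>2 \<le> (\<integral>x. (f x)\<^sup>2 \<partial>M)"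
proof -
  have "\<bar>(f x)\<^sup>2\<bar> \<le> B\<^sup>2" for x
    using b[of x] by (simp add: abs_le_square_iff[symmetric])
  then have i: "integrable M f" "integrable M (\<lambda>x. (f x)\<^sup>2)"
    using b by (auto intro: integrable_const_bound[where B=B] integrable_const_bound[where B="B\<^sup>2"])
  show ?thesis
    using variance_eq[OF i] variance_positive[of f] by simp
qed

lemma (in prob_space) variance_half_difference:
  fixes f :: "'a \<Rightarrow> real"
  assumes [measurable]: "f \<in> borel_measurable M" and b: "\<And>x. \<bar>f x\<bar> \<le> B"
  shows "(\<integral>x. (f x)\<^sup>2 \<partial>M) - (\<integral>x. f x \<partial>M)\<^sup>2 = (1 / 2) * (\<integral>x. \<integral>y. (f x - f y)\<^sup>2 \<partial>M \<partial>M)"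
proof -
  have "\<bar>(f x)\<^sup>2\<bar> \<le> B\<^sup>2" for x
    using b[of x] by (simp add: abs_le_square_iff[symmetric])
  then have i: "integrable M f" "integrable M (\<lambda>x. (f x)\<^sup>2)"
    using b by (auto intro: integrable_const_bound[where B=B] integrable_const_bound[where B="B\<^sup>2"])
  have "(\<integral>y. (f x - f y)\<^sup>2 \<partial>M) = (f x)\<^sup>2 - 2 * f x * (\<integral>y. f y \<partial>M) + (\<integral>y. (f y)\<^sup>2 \<partial>M)" for x
    using i by (simp add: power2_diff prob_space)
  then show ?thesis
    using i by (simp add: prob_space power2_eq_square)
qed

lemma (in prob_space) abs_expectation_le:
  fixes f :: "'a \<Rightarrow> real"
  assumes "\<And>x. \<bar>f x\<bar> \<le> B"
  shows "\<bar>\<integral>x. f x \<partial>M\<bar> \<le> B"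
proof (cases "integrable M f")
  case True
  have "norm (\<integral>x. f x \<partial>M) \<le> (\<integral>x. norm (f x) \<partial>M)"
    by (rule integral_norm_bound)
  also have "\<dots> \<le> (\<integral>x. B \<partial>M)"
    using True assms by (intro integral_mono) auto
  finally show ?thesis by (simp add: prob_space)
next
  case False
  then show ?thesis
    using assms[of undefined] by (simp add: not_integrable_integral_eq)
qed

text \<open>Induction on the coordinates by the law of total variance. With coordinate
  \<open>i\<close> frozen, the induction hypothesis bounds the inner variance. The variance of the
  conditional mean is half the mean squared difference of two independent copies, and Jensen's
  inequality moves the square inside the mean over the remaining coordinates.\<close>

theorem efron_stein:
  fixes f :: "('i \<Rightarrow> 'a) \<Rightarrow> real"
  assumes M: "\<And>j. prob_space (M j)" and "finite I"
    and "f \<in> borel_measurable (PiM I M)" and "\<And>X. \<bar>f X\<bar> \<le> B"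
  shows "(\<integral>X. (f X)\<^sup>2 \<partial>PiM I M) - (\<integral>X. f X \<partial>PiM I M)\<^sup>2
    \<le> (1 / 2) * (\<Sum>i\<in>I. \<integral>X. \<integral>z. (f X - f (X(i := z)))\<^sup>2 \<partial>M i \<partial>PiM I M)"
  using \<open>finite I\<close> assms(3,4)
proof (induction I arbitrary: f rule: finite_induct)
  case empty
  interpret prob_space "PiM {} M" by (intro prob_space_PiM M)
  have "(\<integral>X. g X \<partial>PiM {} M) = g (\<lambda>_. undefined)" for g :: "_ \<Rightarrow> real"
  proof -
    have "(\<integral>X. g X \<partial>PiM {} M) = (\<integral>X. g (\<lambda>_. undefined) \<partial>PiM {} M)"
      by (intro Bochner_Integration.integral_cong) (auto simp: space_PiM)
    then show ?thesis by (simp add: prob_space)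
  qed
  then show ?case by simp
next
  case (insert i I)
  note [measurable] = insert.prems(1) and b = insert.prems(2)
  interpret N: prob_space "M i" by (rule M)
  interpret I: prob_space "PiM I M" by (intro prob_space_PiM M)
  interpret J: prob_space "M j" for j by (rule M)
  interpret IN: pair_prob_space "PiM I M" "M i" ..
  have sq: "\<bar>(f X - f Y)\<^sup>2\<bar> \<le> (2 * B)\<^sup>2" for X Y
  proof -
    have "\<bar>f X - f Y\<bar> \<le> \<bar>2 * B\<bar>"
      using b[of X] b[of Y] by linarith
    then show ?thesis
      by (simp only: abs_le_square_iff abs_power2)
  qed
  have sq1: "\<bar>(f X)\<^sup>2\<bar> \<le> B\<^sup>2" for X
    using b[of X] by (simp add: abs_le_square_iff[symmetric])
  have [measurable]: "(\<lambda>(X, y). f (X(i := y))) \<in> borel_measurable (PiM I M \<Otimes>\<^sub>M M i)"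
    using measurable_compose[OF measurable_add_dim insert.prems(1)] by (simp add: case_prod_unfold)
  have fm [measurable (raw)]: "(\<lambda>w. f ((g w)(i := h w))) \<in> borel_measurable K"
    if "g \<in> measurable K (PiM I M)" "h \<in> measurable K (M i)" for g h and K :: "'c measure"
    using measurable_compose[OF measurable_fun_upd[of "insert i I" I i g K M h] insert.prems(1)] that by simp
  have diff_m: "(\<lambda>X. \<integral>z. (f X - f (X(j := z)))\<^sup>2 \<partial>M j) \<in> borel_measurable (PiM (insert i I) M)"
    if "j \<in> insert i I" for j
  proof -
    have [measurable]: "(\<lambda>w. f ((fst w)(j := snd w))) \<in> borel_measurable (PiM (insert i I) M \<Otimes>\<^sub>M M j)"
      by (rule measurable_compose[OF fun_upd_measurable[OF that measurable_fst measurable_snd] insert.prems(1)])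
    show ?thesis
      by measurable
  qed
  have diff_m': "(\<lambda>y. \<integral>X. \<integral>z. (f (X(i := y)) - f (X(j := z, i := y)))\<^sup>2 \<partial>M j \<partial>PiM I M) \<in> borel_measurable (M i)"
    if "j \<in> I" for j
  proof -
    have [measurable]: "(\<lambda>w. (snd (fst w))(j := snd w)) \<in> measurable ((M i \<Otimes>\<^sub>M PiM I M) \<Otimes>\<^sub>M M j) (PiM I M)"
      by (rule fun_upd_measurable[OF that]) measurable
    show ?thesis
      by measurable
  qed
  \<comment> \<open>\<open>G\<close> and \<open>S\<close> are the conditional first and second
    moments given coordinate \<open>i\<close>. \<open>V j\<close> is the \<open>j\<close>-th term of
    the claim, and \<open>W j\<close> is its conditional version for \<open>j\<close> in
    \<open>I\<close>.\<close>
  define G where "G y = (\<integral>X. f (X(i := y)) \<partial>PiM I M)" for y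
  define V where "V j = (\<integral>X. \<integral>z. (f X - f (X(j := z)))\<^sup>2 \<partial>M j \<partial>PiM (insert i I) M)" for j
  define W where "W j y = (\<integral>X. \<integral>z. (f (X(i := y)) - f (X(j := z, i := y)))\<^sup>2 \<partial>M j \<partial>PiM I M)" for j y
  define S where "S y = (\<integral>X. (f (X(i := y)))\<^sup>2 \<partial>PiM I M)" for y
  have [measurable]: "G \<in> borel_measurable (M i)" "S \<in> borel_measurable (M i)"
    unfolding G_def S_def by measurable
  have W_m [measurable]: "W j \<in> borel_measurable (M i)" if "j \<in> I" for j
    unfolding W_def using that by (rule diff_m')
  have G_b: "\<bar>G y\<bar> \<le> B" and S_b: "\<bar>S y\<bar> \<le> B\<^sup>2" and W_b: "\<bar>W j y\<bar> \<le> (2 * B)\<^sup>2" for y j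
    unfolding G_def S_def W_def
    by (rule I.abs_expectation_le, rule b)
       (rule I.abs_expectation_le, rule sq1, rule I.abs_expectation_le, rule J.abs_expectation_le, rule sq)
  have G2_b: "\<bar>(G y)\<^sup>2\<bar> \<le> B\<^sup>2" for y
    using G_b[of y] by (simp add: abs_le_square_iff[symmetric])
  have int: "integrable (M i) G" "integrable (M i) S" "integrable (M i) (\<lambda>y. (G y)\<^sup>2)"
    using G_b S_b G2_b
    by (auto intro: N.integrable_const_bound[where B=B] N.integrable_const_bound[where B="B\<^sup>2"] simp del: abs_power2)
  have intW: "integrable (M i) (W j)" if "j \<in> I" for j
    using W_b W_m[OF that] by (auto intro: N.integrable_const_bound[where B="(2 * B)\<^sup>2"])
  have S1: "(\<integral>X. (f X)\<^sup>2 \<partial>PiM (insert i I) M) = (\<integral>y. S y \<partial>M i)"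
    unfolding S_def using sq1 by (intro integral_PiM_insert_swap M insert.hyps) auto
  have S2: "(\<integral>X. f X \<partial>PiM (insert i I) M) = (\<integral>y. G y \<partial>M i)"
    unfolding G_def using b by (intro integral_PiM_insert_swap M insert.hyps) auto
  have S3: "S y \<le> (G y)\<^sup>2 + (1 / 2) * (\<Sum>j\<in>I. W j y)" if y: "y \<in> space (M i)" for y
  proof -
    have "(\<lambda>X. f (X(i := y))) \<in> borel_measurable (PiM I M)"
      using y by measurable
    from insert.IH[OF this b] show ?thesis
      unfolding S_def G_def W_def by linarith
  qed
  have S4: "(\<integral>y. W j y \<partial>M i) = V j" if j: "j \<in> I" for j
  proof -
    have ji: "j \<noteq> i" using j insert.hyps by auto
    have "V j = (\<integral>y. \<integral>X. \<integral>z. (f (X(i := y)) - f (X(i := y, j := z)))\<^sup>2 \<partial>M j \<partial>PiM I M \<partial>M i)"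
      unfolding V_def
    proof (rule integral_PiM_insert_swap[where B="(2 * B)\<^sup>2", OF M insert.hyps])
      show "(\<lambda>X. \<integral>z. (f X - f (X(j := z)))\<^sup>2 \<partial>M j) \<in> borel_measurable (PiM (insert i I) M)"
        using j by (intro diff_m) simp
    qed (intro J.abs_expectation_le sq)
    then show ?thesis
      using ji by (simp add: W_def fun_upd_twist)
  qed
  \<comment> \<open>Jensen's inequality: the difference of two conditional means is controlled by
    the mean squared effect of resampling coordinate \<open>i\<close>.\<close>
  have S6: "(G y - G z)\<^sup>2 \<le> (\<integral>X. (f (X(i := y)) - f (X(i := z)))\<^sup>2 \<partial>PiM I M)"
    if y [measurable]: "y \<in> space (M i)" and z [measurable]: "z \<in> space (M i)" for y z
  proof -
    have "integrable (PiM I M) (\<lambda>X. f (X(i := y)))" "integrable (PiM I M) (\<lambda>X. f (X(i := z)))"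
      using y z b by (auto intro!: I.integrable_const_bound[where B=B])
    then have "G y - G z = (\<integral>X. f (X(i := y)) - f (X(i := z)) \<partial>PiM I M)"
      by (simp add: G_def)
    moreover have "(\<lambda>X. f (X(i := y)) - f (X(i := z))) \<in> borel_measurable (PiM I M)"
      using y z by measurable
    moreover have "\<bar>f X - f Y\<bar> \<le> 2 * B" for X Y
      using b[of X] b[of Y] by simp
    ultimately show ?thesis
      using I.square_expectation_le[of "\<lambda>X. f (X(i := y)) - f (X(i := z))" "2 * B"] by simp
  qed
  have S7: "V i = (\<integral>y. \<integral>z. \<integral>X. (f (X(i := y)) - f (X(i := z)))\<^sup>2 \<partial>PiM I M \<partial>M i \<partial>M i)"
  proof -
    have "V i = (\<integral>y. \<integral>X. \<integral>z. (f (X(i := y)) - f (X(i := y, i := z)))\<^sup>2 \<partial>M i \<partial>PiM I M \<partial>M i)"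
      unfolding V_def
    proof (rule integral_PiM_insert_swap[where B="(2 * B)\<^sup>2", OF M insert.hyps])
      show "(\<lambda>X. \<integral>z. (f X - f (X(i := z)))\<^sup>2 \<partial>M i) \<in> borel_measurable (PiM (insert i I) M)"
        by (intro diff_m) simp
    qed (intro J.abs_expectation_le sq)
    also have "\<dots> = (\<integral>y. \<integral>z. \<integral>X. (f (X(i := y)) - f (X(i := z)))\<^sup>2 \<partial>PiM I M \<partial>M i \<partial>M i)"
    proof (intro Bochner_Integration.integral_cong refl)
      fix y assume y [measurable]: "y \<in> space (M i)"
      have "(\<lambda>(X, z). (f (X(i := y)) - f (X(i := z)))\<^sup>2) \<in> borel_measurable (PiM I M \<Otimes>\<^sub>M M i)"
        by measurable
      then show "(\<integral>X. \<integral>z. (f (X(i := y)) - f (X(i := y, i := z)))\<^sup>2 \<partial>M i \<partial>PiM I M)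
        = (\<integral>z. \<integral>X. (f (X(i := y)) - f (X(i := z)))\<^sup>2 \<partial>PiM I M \<partial>M i)"
        using sq unfolding fun_upd_upd
        by (intro IN.Fubini_integral[symmetric] IN.integrable_const_bound[where B="(2 * B)\<^sup>2"]) auto
    qed
    finally show ?thesis .
  qed
  have S8: "(\<integral>y. (G y)\<^sup>2 \<partial>M i) - (\<integral>y. G y \<partial>M i)\<^sup>2 \<le> (1 / 2) * V i"
  proof -
    have b2: "\<bar>(G y - G z)\<^sup>2\<bar> \<le> (2 * B)\<^sup>2" for y z
    proof -
      have "\<bar>G y - G z\<bar> \<le> \<bar>2 * B\<bar>"
        using G_b[of y] G_b[of z] by linarith
      then show ?thesis
        by (simp only: abs_le_square_iff abs_power2)
    qed
    have "(\<integral>y. \<integral>z. (G y - G z)\<^sup>2 \<partial>M i \<partial>M i) \<le> V i"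
      unfolding S7
    proof (intro integral_mono)
      show "integrable (M i) (\<lambda>y. \<integral>z. (G y - G z)\<^sup>2 \<partial>M i)"
        by (rule N.integrable_const_bound[where B="(2 * B)\<^sup>2"], rule AE_I2,
            simp only: real_norm_def, rule N.abs_expectation_le, rule b2) measurable
      show "integrable (M i) (\<lambda>y. \<integral>z. \<integral>X. (f (X(i := y)) - f (X(i := z)))\<^sup>2 \<partial>PiM I M \<partial>M i)"
        by (rule N.integrable_const_bound[where B="(2 * B)\<^sup>2"], rule AE_I2,
            simp only: real_norm_def, rule N.abs_expectation_le, rule I.abs_expectation_le, rule sq) measurable
    next
      fix y assume [measurable]: "y \<in> space (M i)"
      show "integrable (M i) (\<lambda>z. (G y - G z)\<^sup>2)"
        using b2 by (intro N.integrable_const_bound[where B="(2 * B)\<^sup>2"] AE_I2) auto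
      show "integrable (M i) (\<lambda>z. \<integral>X. (f (X(i := y)) - f (X(i := z)))\<^sup>2 \<partial>PiM I M)"
        by (rule N.integrable_const_bound[where B="(2 * B)\<^sup>2"], rule AE_I2,
            simp only: real_norm_def, rule I.abs_expectation_le, rule sq) measurable
    qed (rule S6)
    then show ?thesis
      using N.variance_half_difference[of G B] G_b by simp
  qed
  have "(\<integral>y. S y \<partial>M i) \<le> (\<integral>y. (G y)\<^sup>2 + (1 / 2) * (\<Sum>j\<in>I. W j y) \<partial>M i)"
    using int intW S3 by (intro integral_mono) auto
  also have "\<dots> = (\<integral>y. (G y)\<^sup>2 \<partial>M i) + (1 / 2) * (\<Sum>j\<in>I. V j)"
    using int intW by (simp add: S4)
  finally have "(\<integral>y. S y \<partial>M i) - (\<integral>y. G y \<partial>M i)\<^sup>2 \<le> (1 / 2) * (\<Sum>j\<in>insert i I. V j)"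
    using S8 insert.hyps by (simp add: distrib_left)
  then show ?case
    unfolding S1 S2 V_def .
qed

text \<open>Coordinate \<open>i\<close> and its replacement have the same law, and both are
  independent of the rest. Thus the number of children of a vertex has the same mean square after a
  move as before.\<close>

lemma integral_PiM_resample:
  fixes g :: "_ \<Rightarrow> real"
  assumes M: "\<And>j. prob_space (M j)" and I: "finite I" "i \<in> I"
    and g [measurable]: "g \<in> borel_measurable (PiM I M)" and b: "\<And>X. \<bar>g X\<bar> \<le> B"
  shows "(\<integral>X. \<integral>z. g (X(i := z)) \<partial>M i \<partial>PiM I M) = (\<integral>X. g X \<partial>PiM I M)"
proof -
  define J where "J = I - {i}"
  have J: "finite J" "i \<notin> J" "insert i J = I"
    using I by (auto simp: J_def)
  interpret N: prob_space "M i" by (rule M)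
  interpret product_prob_space M I
    by (intro product_prob_spaceI M)
  have [measurable]: "(\<lambda>w. g ((fst w)(i := snd w))) \<in> borel_measurable (PiM I M \<Otimes>\<^sub>M M i)"
    by (rule measurable_compose[OF fun_upd_measurable[OF I(2) measurable_fst measurable_snd] g])
  have "(\<lambda>X. \<integral>z. g (X(i := z)) \<partial>M i) \<in> borel_measurable (PiM I M)"
    by measurable
  moreover have "AE X in PiM I M. norm (\<integral>z. g (X(i := z)) \<partial>M i) \<le> B"
    using N.abs_expectation_le[OF b] by simp
  ultimately have "integrable (PiM I M) (\<lambda>X. \<integral>z. g (X(i := z)) \<partial>M i)"
    by (intro P.integrable_const_bound)
  then have "(\<integral>X. \<integral>z. g (X(i := z)) \<partial>M i \<partial>PiM I M) = (\<integral>X. \<integral>y. \<integral>z. g (X(i := y, i := z)) \<partial>M i \<partial>M i \<partial>PiM J M)"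
    using product_integral_insert[OF J(1,2), of "\<lambda>X. \<integral>z. g (X(i := z)) \<partial>M i"] J(3) by simp
  also have "\<dots> = (\<integral>X. \<integral>z. g (X(i := z)) \<partial>M i \<partial>PiM J M)"
    by (simp add: N.prob_space)
  also have "\<dots> = (\<integral>X. g X \<partial>PiM I M)"
    using product_integral_insert[OF J(1,2), of g] J(3) b
    by (simp add: P.integrable_const_bound[where B=B])
  finally show ?thesis .
qed

text \<open>If one image contains a point that the other misses, its preimages in \<open>A\<close>
  all lie in \<open>B\<close>. For the parent maps before and after a move, \<open>B\<close>
  collects the vertices whose parent may change.\<close>

lemma card_image_diff_le:
  fixes g h :: "'a \<Rightarrow> 'b"
  assumes "finite A" "finite B" "\<And>k. k \<in> A \<Longrightarrow> k \<notin> B \<Longrightarrow> g k = h k"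
  shows "\<bar>real (card (g ` A)) - real (card (h ` A))\<bar> \<le> real (card B)"
proof -
  have "card (g ` A) \<le> card (h ` A) + card B"
    if "\<And>k. k \<in> A \<Longrightarrow> k \<notin> B \<Longrightarrow> g k = h k" for g h :: "'a \<Rightarrow> 'b"
  proof -
    have "g ` A \<subseteq> h ` A \<union> g ` B"
      using that by force
    then have "card (g ` A) \<le> card (h ` A \<union> g ` B)"
      using assms by (intro card_mono) auto
    also have "\<dots> \<le> card (h ` A) + card (g ` B)"
      by (rule card_Un_le)
    also have "\<dots> \<le> card (h ` A) + card B"
      using card_image_le[OF assms(2), of g] by simp
    finally show ?thesis .
  qed
  from this[of g h] this[of h g] show ?thesis
    using assms(3) by simp
qed

lemma pred_le_measurable [measurable (raw)]:
  fixes f g :: "'a \<Rightarrow> real"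
  shows "f \<in> borel_measurable M \<Longrightarrow> g \<in> borel_measurable M \<Longrightarrow> Measurable.pred M (\<lambda>w. f w \<le> g w)"
    "f \<in> borel_measurable M \<Longrightarrow> g \<in> borel_measurable M \<Longrightarrow> Measurable.pred M (\<lambda>w. f w = g w)"
  unfolding Measurable.pred_def by (auto intro: borel_measurable_le borel_measurable_eq)

lemma geometric_sum_le:
  fixes c :: real
  assumes "0 < c" "c \<le> 1"
  shows "(\<Sum>j<n. (1 - c) ^ j) \<le> 1 / c"
proof -
  have "(\<Sum>j<n. (1 - c) ^ j) = (1 - (1 - c) ^ n) / c"
    using assms by (subst sum_gp_strict) auto
  also have "\<dots> \<le> 1 / c"
    using assms by (intro divide_right_mono) auto
  finally show ?thesis .
qed

lemma harmonic_le_ln: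
  assumes "n \<ge> 1"
  shows "(\<Sum>i<n. 1 / (real i + 1)) \<le> ln (real n) + 1"
  using assms
proof (induction n rule: nat_induct_at_least)
  case base
  then show ?case by simp
next
  case (Suc n)
  have "ln (real n / (real n + 1)) \<le> real n / (real n + 1) - 1"
    using Suc.hyps by (intro ln_le_minus_one) auto
  also have "\<dots> = - (1 / (real n + 1))"
    by (simp add: field_simps)
  finally have "1 / (real n + 1) \<le> ln (real n + 1) - ln (real n)"
    using Suc.hyps by (simp add: ln_div)
  then show ?case
    using Suc.IH by (simp add: add.commute)
qed

subsection \<open>The torus\<close>

definition lattice_vec :: "real \<Rightarrow> int^'d \<Rightarrow> real^'d" where
  "lattice_vec s k = s *\<^sub>R (\<chi> i. of_int (k $ i))"

definition half_open_box :: "real \<Rightarrow> real \<Rightarrow> (real^'d) set" where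
  "half_open_box s b = {x. \<forall>i. b \<le> x $ i \<and> x $ i < b + s}"

text \<open>For \<open>s > 0\<close> this is the representative of \<open>z\<close> modulo the
  lattice in the half-open cube with lower corner \<open>b\<close> in every coordinate. The cube
  with \<open>b = 0\<close> carries the samples; the centred one, \<open>b = - (s / 2)\<close>,
  serves for distances.\<close>

definition wrap :: "real \<Rightarrow> real \<Rightarrow> real^'d \<Rightarrow> real^'d" where
  "wrap s b z = (\<chi> i. z $ i - s * of_int \<lfloor>(z $ i - b) / s\<rfloor>)"

abbreviation centred :: "real \<Rightarrow> real^'d \<Rightarrow> real^'d" where
  "centred s \<equiv> wrap s (- (s / 2))"

definition torus_norm :: "real \<Rightarrow> real^'d \<Rightarrow> real" where
  "torus_norm s z = norm (centred s z)"

lemma lattice_vec_nth [simp]: "lattice_vec s k $ i = s * of_int (k $ i)"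
  by (simp add: lattice_vec_def)

lemma lattice_vec_add: "lattice_vec s (k + l) = lattice_vec s k + lattice_vec s l"
  by (simp add: vec_eq_iff algebra_simps)

lemma lattice_vec_0 [simp]: "lattice_vec s 0 = 0"
  by (simp add: vec_eq_iff)

lemma lattice_vec_minus: "lattice_vec s (- k) = - lattice_vec s k"
  by (simp add: vec_eq_iff)

lemma wrap_in_box:
  assumes "s > 0"
  shows "wrap s b z \<in> half_open_box s b"
proof -
  have "b \<le> z $ i - s * of_int \<lfloor>(z $ i - b) / s\<rfloor> \<and> z $ i - s * of_int \<lfloor>(z $ i - b) / s\<rfloor> < b + s" for i
  proof -
    have "of_int \<lfloor>(z $ i - b) / s\<rfloor> \<le> (z $ i - b) / s" "(z $ i - b) / s < of_int \<lfloor>(z $ i - b) / s\<rfloor> + 1"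
      by linarith+
    then have "of_int \<lfloor>(z $ i - b) / s\<rfloor> * s \<le> z $ i - b" "z $ i - b < (of_int \<lfloor>(z $ i - b) / s\<rfloor> + 1) * s"
      using assms by (simp_all only: pos_le_divide_eq pos_divide_less_eq)
    then show ?thesis
      by (simp add: algebra_simps)
  qed
  then show ?thesis
    by (simp add: half_open_box_def wrap_def)
qed

lemma wrap_lattice: "\<exists>k. wrap s b z = z + lattice_vec s k"
  by (rule exI[of _ "\<chi> i. - \<lfloor>(z $ i - b) / s\<rfloor>"]) (simp add: vec_eq_iff wrap_def)

lemma wrap_unique:
  assumes "s > 0" "z + lattice_vec s k \<in> half_open_box s b"
  shows "wrap s b z = z + lattice_vec s k"
proof -
  have "\<lfloor>(z $ i - b) / s\<rfloor> = - (k $ i)" for i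
  proof -
    have "b \<le> z $ i + s * of_int (k $ i)" "z $ i + s * of_int (k $ i) < b + s"
      using assms(2) by (auto simp: half_open_box_def)
    then have "of_int (- (k $ i)) \<le> (z $ i - b) / s" "(z $ i - b) / s < of_int (- (k $ i)) + 1"
      using assms(1) by (auto simp: field_simps)
    then show ?thesis
      by linarith
  qed
  then show ?thesis
    by (simp add: vec_eq_iff wrap_def)
qed

lemma wrap_id: "s > 0 \<Longrightarrow> z \<in> half_open_box s b \<Longrightarrow> wrap s b z = z"
  using wrap_unique[of s z 0 b] by simp

lemma wrap_add_lattice:
  assumes "s > 0"
  shows "wrap s b (z + lattice_vec s k) = wrap s b z"
proof -
  obtain l where l: "wrap s b z = z + lattice_vec s l"
    using wrap_lattice by blast
  have "wrap s b (z + lattice_vec s k) = z + lattice_vec s k + lattice_vec s (l - k)"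
    using wrap_in_box[OF assms, of b z] l lattice_vec_add[of s k "l - k"]
    by (intro wrap_unique assms) (simp add: algebra_simps)
  also have "\<dots> = wrap s b z"
    using lattice_vec_add[of s k "l - k"] l by (simp add: algebra_simps)
  finally show ?thesis .
qed

lemma wrap_add_wrap:
  assumes "s > 0"
  shows "wrap s b (y + wrap s c z) = wrap s b (y + z)" "wrap s b (wrap s c z - y) = wrap s b (z - y)"
    "wrap s b (y - wrap s c z) = wrap s b (y - z)"
proof -
  obtain k where k: "wrap s c z = z + lattice_vec s k"
    using wrap_lattice by blast
  show "wrap s b (y + wrap s c z) = wrap s b (y + z)"
    unfolding k using wrap_add_lattice[OF assms, of b "y + z" k] by (simp add: algebra_simps)
  show "wrap s b (wrap s c z - y) = wrap s b (z - y)"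
    unfolding k using wrap_add_lattice[OF assms, of b "z - y" k] by (simp add: algebra_simps)
  show "wrap s b (y - wrap s c z) = wrap s b (y - z)"
    unfolding k using wrap_add_lattice[OF assms, of b "y - z" "-k"]
    by (simp add: algebra_simps lattice_vec_minus)
qed

lemma small_in_box:
  assumes "norm (v :: real^'d) < s / 2"
  shows "v \<in> half_open_box s (- (s / 2))"
proof -
  have "\<bar>v $ i\<bar> < s / 2" for i
    using assms component_le_norm_cart[of v i] by simp
  then show ?thesis
    by (simp add: half_open_box_def abs_less_iff) (smt (verit) field_sum_of_halves)
qed

text \<open>Coordinatewise, a number in \<open>[-s/2, s/2)\<close> has the least absolute value in
  its class modulo \<open>s\<close>. Hence the norm of the centred representative is the quotient
  norm, and later arguments avoid the infimum over the lattice.\<close>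

lemma torus_norm_le:
  assumes "s > 0"
  shows "torus_norm s z \<le> norm (z + lattice_vec s k)"
proof -
  obtain l where l: "centred s z = z + lattice_vec s l"
    using wrap_lattice by blast
  have "\<bar>centred s z $ i\<bar> \<le> \<bar>(z + lattice_vec s k) $ i\<bar>" for i
  proof -
    define m where "m = k $ i - l $ i"
    have c: "- (s / 2) \<le> centred s z $ i" "centred s z $ i < s / 2"
      using wrap_in_box[OF assms, of "- (s / 2)" z] by (auto simp: half_open_box_def)
    have e: "(z + lattice_vec s k) $ i = centred s z $ i + s * of_int m"
      unfolding l by (simp add: m_def algebra_simps)
    consider "m = 0" | "m \<ge> 1" | "m \<le> -1" by linarith
    then show ?thesis
    proof cases
      case 1 then show ?thesis using e by simp
    next
      case 2
      then have "s * of_int m \<ge> s" using assms by simp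
      then show ?thesis using e c by linarith
    next
      case 3
      then have "of_int m \<le> (-1::real)" by linarith
      then have "s * of_int m \<le> s * (-1)" using assms by (intro mult_left_mono) auto
      then show ?thesis using e c by linarith
    qed
  qed
  then show ?thesis
    unfolding torus_norm_def by (intro norm_le_componentwise_cart) simp
qed

lemma torus_norm_le_norm: "s > 0 \<Longrightarrow> torus_norm s z \<le> norm z"
  using torus_norm_le[of s z 0] by simp

lemma torus_norm_eq: "s > 0 \<Longrightarrow> norm z < s / 2 \<Longrightarrow> torus_norm s z = norm z"
  by (simp add: torus_norm_def wrap_id small_in_box)

text \<open>The half-open cube is not symmetric, so \<open>centred\<close> fails to commute with
  negation on its boundary. Minimality of the norm within the class gives the equality
  instead.\<close>

lemma torus_norm_minus:
  assumes "s > 0"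
  shows "torus_norm s (- z) = torus_norm s (z :: real^'d)"
proof -
  have "torus_norm s (- z) \<le> torus_norm s z" for z :: "real^'d"
  proof -
    obtain l where l: "centred s z = z + lattice_vec s l"
      using wrap_lattice by blast
    have "torus_norm s (- z) \<le> norm (- z + lattice_vec s (- l))"
      by (rule torus_norm_le[OF assms])
    also have "\<dots> = torus_norm s z"
      unfolding torus_norm_def l lattice_vec_minus by (metis minus_add_distrib norm_minus_cancel)
    finally show ?thesis .
  qed
  from this[of z] this[of "-z"] show ?thesis by simp
qed

lemma torus_norm_wrap:
  assumes "s > 0"
  shows "torus_norm s (wrap s c z - y) = torus_norm s (z - y)"
    "torus_norm s (y - wrap s c z) = torus_norm s (y - z)"
    "torus_norm s (wrap s c z) = torus_norm s z"
  using wrap_add_wrap(1)[OF assms, of "- (s/2)" 0 c z]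
  by (simp_all add: torus_norm_def wrap_add_wrap[OF assms])

lemma torus_dist_eq:
  fixes x y :: "real^'d"
  assumes "n \<ge> 1"
  shows "torus_dist n x y = torus_norm (root CARD('d) (real n)) (x - y)"
proof -
  define s where "s = root CARD('d) (real n)"
  have s: "s > 0"
    using assms by (simp add: s_def)
  obtain l where l: "centred s (x - y) = x - y + lattice_vec s l"
    using wrap_lattice by blast
  have d: "dist x (y + s *\<^sub>R (\<chi> i. of_int (k $ i))) = norm (x - y + lattice_vec s (- k))" for k :: "int^'d"
    unfolding dist_norm lattice_vec_minus by (simp add: lattice_vec_def algebra_simps)
  have "(INF k::int^'d. dist x (y + s *\<^sub>R (\<chi> i. of_int (k $ i)))) = torus_norm s (x - y)"
  proof (rule cInf_eq_minimum)
    show "torus_norm s (x - y) \<in> range (\<lambda>k::int^'d. dist x (y + s *\<^sub>R (\<chi> i. of_int (k $ i))))"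
      by (rule image_eqI[of _ _ "- l"]) (simp_all only: d minus_minus torus_norm_def l UNIV_I)
  qed (auto simp: d intro: torus_norm_le[OF s])
  then show ?thesis
    by (simp add: torus_dist_def s_def)
qed

lemma wrap_measurable [measurable]: "wrap s b \<in> borel_measurable borel"
  by (rule borel_measurable_euclidean_space[THEN iffD2])
     (auto simp: Basis_vec_def wrap_def inner_axis)

text \<open>The reflection in the perpendicular bisector of \<open>0\<close> and \<open>a\<close>,
  which exchanges these two points; for \<open>a = 0\<close> it is the identity.\<close>

definition reflect :: "real^'d \<Rightarrow> real^'d \<Rightarrow> real^'d" where
  "reflect a v = v - (2 * (v \<bullet> a) / (a \<bullet> a) - 1) *\<^sub>R a"

text \<open>The symmetric difference of the closed balls of radius \<open>norm a\<close> around
  \<open>0\<close> and \<open>a\<close>. The balls are closed because a competitor outside has to be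
  strictly farther away.\<close>

definition lune_pair :: "real^'d \<Rightarrow> (real^'d) set" where
  "lune_pair a = {v. norm v \<le> norm a \<and> norm a < norm (v - a) \<or> norm (v - a) \<le> norm a \<and> norm a < norm v}"

text \<open>The two lunes are mirror images, so exchanging them and fixing everything else is a
  bijection. It moves points only near \<open>0\<close> and \<open>a\<close>, which makes it usable
  on a torus, unlike the full reflection.\<close>

definition lune_swap :: "real^'d \<Rightarrow> real^'d \<Rightarrow> real^'d" where
  "lune_swap a v = (if v \<in> lune_pair a then reflect a v else v)"

text \<open>Coordinates are centred at \<open>w\<close>, so that \<open>w\<close> and
  \<open>u\<close> become \<open>0\<close> and \<open>a\<close>. In the application \<open>w\<close>
  is a parent, \<open>u\<close> its child and \<open>x\<close> another vertex older than
  \<open>u\<close>.\<close>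

definition torus_swap :: "real \<Rightarrow> real^'d \<Rightarrow> real^'d \<Rightarrow> real^'d \<Rightarrow> real^'d" where
  "torus_swap s w u x = wrap s 0 (lune_swap (centred s (u - w)) (centred s (x - w)) + w)"

section \<open>The uniform law on the torus: invariance, volumes of balls, ties\<close>

definition torus_unif :: "real \<Rightarrow> real \<Rightarrow> (real^'d) measure" where
  "torus_unif s b = uniform_measure lborel (half_open_box s b)"

lemma sets_torus_unif [simp]: "sets (torus_unif s b) = sets borel"
  by (simp add: torus_unif_def)

lemma space_torus_unif [simp]: "space (torus_unif s b) = UNIV"
  by (simp add: torus_unif_def)

lemma half_open_box_borel [measurable]: "(half_open_box s b :: (real^'d) set) \<in> sets borel"
proof -
  have "half_open_box s b = (\<Inter>i. {x :: real^'d . b \<le> x $ i \<and> x $ i < b + s})"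
    by (auto simp: half_open_box_def)
  then show ?thesis by simp
qed

lemma emeasure_lborel_cube:
  fixes l u :: real
  assumes "l \<le> u"
  shows "emeasure lborel (cbox (\<chi> i. l) (\<chi> i. u) :: (real^'d) set) = ennreal ((u - l) ^ CARD('d))"
    and "emeasure lborel (box (\<chi> i. l) (\<chi> i. u) :: (real^'d) set) = ennreal ((u - l) ^ CARD('d))"
proof -
  have "(\<Prod>b\<in>Basis. ((\<chi> i. u) - (\<chi> i. l) :: real^'d) \<bullet> b) = (\<Prod>b\<in>(Basis::(real^'d) set). u - l)"
    by (intro prod.cong) (auto simp: Basis_vec_def inner_axis)
  then have *: "(\<Prod>b\<in>Basis. ((\<chi> i. u) - (\<chi> i. l) :: real^'d) \<bullet> b) = (u - l) ^ CARD('d)"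
    by simp
  have le: "(\<chi> i. l) \<bullet> b \<le> (\<chi> i. u) \<bullet> b" if "b \<in> Basis" for b :: "real^'d"
    using that assms by (auto simp: Basis_vec_def inner_axis)
  show "emeasure lborel (cbox (\<chi> i. l) (\<chi> i. u) :: (real^'d) set) = ennreal ((u - l) ^ CARD('d))"
    using emeasure_lborel_cbox[OF le] unfolding * .
  show "emeasure lborel (box (\<chi> i. l) (\<chi> i. u) :: (real^'d) set) = ennreal ((u - l) ^ CARD('d))"
    using emeasure_lborel_box[OF le] unfolding * .
qed

lemma emeasure_half_open_box:
  assumes "s > 0"
  shows "emeasure lborel (half_open_box s b :: (real^'d) set) = ennreal (s ^ CARD('d))"
proof (rule antisym)
  have "emeasure lborel (half_open_box s b :: (real^'d) set) \<le> emeasure lborel (cbox (\<chi> i. b) (\<chi> i. b + s) :: (real^'d) set)"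
    by (intro emeasure_mono) (auto simp: half_open_box_def mem_box_cart less_imp_le)
  then show "emeasure lborel (half_open_box s b :: (real^'d) set) \<le> ennreal (s ^ CARD('d))"
    using assms by (simp add: emeasure_lborel_cube)
  have "emeasure lborel (box (\<chi> i. b) (\<chi> i. b + s) :: (real^'d) set) \<le> emeasure lborel (half_open_box s b :: (real^'d) set)"
    by (intro emeasure_mono) (auto simp: half_open_box_def mem_box_cart less_imp_le)
  then show "ennreal (s ^ CARD('d)) \<le> emeasure lborel (half_open_box s b :: (real^'d) set)"
    using assms by (simp add: emeasure_lborel_cube)
qed

lemma prob_space_torus_unif: "s > 0 \<Longrightarrow> prob_space (torus_unif s b)"
  unfolding torus_unif_def
  by (rule prob_space_uniform_measure) (simp_all add: emeasure_half_open_box)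

lemma emeasure_lborel_translate:
  assumes "A \<in> sets borel"
  shows "emeasure lborel {x :: real^'d. x + c \<in> A} = emeasure lborel A"
proof -
  have "emeasure lborel A = emeasure (distr lborel borel ((+) c)) A"
    by (simp only: lborel_distr_plus)
  also have "\<dots> = emeasure lborel {x. x + c \<in> A}"
    using assms by (subst emeasure_distr) (auto simp: vimage_def add.commute)
  finally show ?thesis by simp
qed

lemma lattice_vec_inj:
  assumes "s > 0" "z + lattice_vec s k \<in> half_open_box s b" "z + lattice_vec s l \<in> half_open_box s b"
  shows "k = l"
proof -
  have "lattice_vec s k = lattice_vec s l"
    using wrap_unique[OF assms(1,2)] wrap_unique[OF assms(1,3)] by simp
  then have "s * of_int (k $ i) = s * of_int (l $ i)" for i
    by (metis lattice_vec_nth)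
  then show ?thesis using assms(1) by (simp add: vec_eq_iff)
qed

text \<open>The set on the left is cut into countably many pieces \<open>P k\<close> on which
  \<open>wrap\<close> adds the same lattice vector. Each piece is a translate of \<open>Q k\<close>,
  and the \<open>Q k\<close> partition the set on the right.\<close>

lemma emeasure_wrap_shift:
  fixes w :: "real^'d"
  assumes "s > 0" and [measurable]: "A \<in> sets borel"
  shows "emeasure lborel (half_open_box s b \<inter> {x. wrap s b' (x + w) \<in> A}) = emeasure lborel (half_open_box s b' \<inter> A)"
proof -
  define P where "P k = half_open_box s b \<inter> {x. x + w + lattice_vec s k \<in> half_open_box s b' \<inter> A}" for k
  define Q where "Q k = half_open_box s b' \<inter> A \<inter> {y. y - w - lattice_vec s k \<in> half_open_box s b}" for k
  have Q_borel [measurable]: "Q k \<in> sets borel" for k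
  proof -
    have "{y. y - w - lattice_vec s k \<in> half_open_box s b} \<in> sets borel"
      by measurable
    then show ?thesis by (simp add: Q_def)
  qed
  have PQ: "P k = {x. x + (w + lattice_vec s k) \<in> Q k}" for k
    by (auto simp: P_def Q_def algebra_simps)
  have P_borel [measurable]: "P k \<in> sets borel" for k
    unfolding PQ by measurable
  have P: "half_open_box s b \<inter> {x. wrap s b' (x + w) \<in> A} = (\<Union>k. P k)"
  proof (intro set_eqI iffI)
    fix x assume x: "x \<in> half_open_box s b \<inter> {x. wrap s b' (x + w) \<in> A}"
    obtain k where "wrap s b' (x + w) = x + w + lattice_vec s k"
      using wrap_lattice by blast
    with x wrap_in_box[OF assms(1), of b' "x + w"] show "x \<in> (\<Union>k. P k)"
      by (auto simp: P_def)
  qed (auto simp: P_def dest: wrap_unique[OF assms(1)])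
  have Q: "half_open_box s b' \<inter> A = (\<Union>k. Q k)"
  proof (intro set_eqI iffI)
    fix y assume y: "y \<in> half_open_box s b' \<inter> A"
    obtain k where "wrap s b (y - w) = y - w + lattice_vec s k"
      using wrap_lattice by blast
    with y wrap_in_box[OF assms(1), of b "y - w"] show "y \<in> (\<Union>k. Q k)"
      by (auto simp: Q_def lattice_vec_minus intro!: exI[of _ "-k"])
  qed (auto simp: Q_def)
  have dP: "disjoint_family P"
    unfolding disjoint_family_on_def P_def using lattice_vec_inj[OF assms(1)] by blast
  have dQ: "disjoint_family Q"
  proof (clarsimp simp: disjoint_family_on_def)
    fix k l :: "int^'d" assume kl: "k \<noteq> l"
    { fix y assume "y \<in> Q k" "y \<in> Q l"
      then have "y - w + lattice_vec s (-k) \<in> half_open_box s b" "y - w + lattice_vec s (-l) \<in> half_open_box s b"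
        by (auto simp: Q_def lattice_vec_minus)
      then have "k = l" using lattice_vec_inj[OF assms(1)] by fastforce }
    then show "Q k \<inter> Q l = {}" using kl by blast
  qed
  have "emeasure lborel (\<Union>k. P k) = (\<integral>\<^sup>+k. emeasure lborel (P k) \<partial>count_space UNIV)"
    using dP by (intro emeasure_UN_countable) auto
  also have "\<dots> = (\<integral>\<^sup>+k. emeasure lborel (Q k) \<partial>count_space UNIV)"
    by (simp add: PQ emeasure_lborel_translate)
  also have "\<dots> = emeasure lborel (\<Union>k. Q k)"
    using dQ by (intro emeasure_UN_countable[symmetric]) auto
  finally show ?thesis
    unfolding P Q .
qed

lemma distr_wrap_shift:
  fixes w :: "real^'d"
  assumes "s > 0"
  shows "distr (torus_unif s b) (torus_unif s b') (\<lambda>x. wrap s b' (x + w)) = torus_unif s b'"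
proof (rule measure_eqI)
  fix A assume "A \<in> sets (distr (torus_unif s b) (torus_unif s b') (\<lambda>x. wrap s b' (x + w)))"
  then have A [measurable]: "A \<in> sets borel" by simp
  have "{x. wrap s b' (x + w) \<in> A} \<in> sets borel"
    by measurable
  then show "emeasure (distr (torus_unif s b) (torus_unif s b') (\<lambda>x. wrap s b' (x + w))) A = emeasure (torus_unif s b') A"
    using emeasure_wrap_shift[OF assms A, of b b' w]
    by (subst emeasure_distr) (auto simp: torus_unif_def vimage_def emeasure_half_open_box[OF assms])
qed simp

text \<open>
  Haar uniqueness: integrating \<open>1\<^sub>B(x) 1\<^sub>A(x + f y)\<close> over \<open>x\<close> and \<open>y\<close> in both orders,
  with \<open>B\<close> the unit ball, compares the image measure with Lebesgue measure.
\<close>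

lemma emeasure_lborel_linear_involution:
  fixes f :: "real^'d \<Rightarrow> real^'d"
  assumes f: "linear f" "\<And>x. norm (f x) = norm x" "\<And>x. f (f x) = x"
    and [measurable]: "A \<in> sets borel"
  shows "emeasure lborel {x. f x \<in> A} = emeasure lborel A"
proof -
  interpret L: linear f by fact
  have fm [measurable]: "f \<in> borel_measurable borel"
    using linear_continuous_on[of f UNIV] f(1)
    by (intro borel_measurable_continuous_onI) (simp add: linear_conv_bounded_linear)
  define B :: "(real^'d) set" where "B = ball 0 1"
  have B [measurable]: "B \<in> sets borel" by (simp add: B_def)
  have e: "(\<integral>\<^sup>+x. indicator C x \<partial>lborel) = emeasure lborel C" if "C \<in> sets borel" for C :: "(real^'d) set"
    using that by simp
  have 1: "(\<integral>\<^sup>+y. indicator B x * indicator A (x + f y) \<partial>lborel) = emeasure lborel {x. f x \<in> A} * indicator B x" for x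
  proof -
    have "(\<integral>\<^sup>+y. indicator B x * indicator A (x + f y) \<partial>lborel)
      = indicator B x * (\<integral>\<^sup>+y. indicator {y. y + f x \<in> {z. f z \<in> A}} y \<partial>lborel)"
      by (subst nn_integral_cmult[symmetric])
         (auto intro!: nn_integral_cong simp: indicator_def L.add f(3) add.commute)
    also have "(\<integral>\<^sup>+y. indicator {y. y + f x \<in> {z. f z \<in> A}} y \<partial>lborel) = emeasure lborel {y. y + f x \<in> {z. f z \<in> A}}"
      by (rule e) measurable
    also have "\<dots> = emeasure lborel {z. f z \<in> A}"
      by (rule emeasure_lborel_translate) measurable
    finally show ?thesis by (simp add: mult.commute)
  qed
  have 2: "(\<integral>\<^sup>+x. indicator B x * indicator A (x + f y) \<partial>lborel) = (\<integral>\<^sup>+x. indicator A x * indicator B (x - f y) \<partial>lborel)" for y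
  proof -
    have "(\<integral>\<^sup>+x. indicator A x * indicator B (x - f y) \<partial>lborel) =
      (\<integral>\<^sup>+x. indicator A x * indicator B (x - f y) \<partial>distr lborel borel ((+) (f y)))"
      by (simp only: lborel_distr_plus)
    also have "\<dots> = (\<integral>\<^sup>+x. indicator A (f y + x) * indicator B (f y + x - f y) \<partial>lborel)"
      by (rule nn_integral_distr) measurable
    finally show ?thesis
      by (simp add: mult.commute add.commute)
  qed
  have 3: "(\<integral>\<^sup>+y. indicator A x * indicator B (x - f y) \<partial>lborel) = emeasure lborel B * indicator A x" for x
  proof -
    have "norm (x - f y) = norm (y + (- f x))" for y
    proof -
      have "norm (x - f y) = norm (f (x - f y))" using f(2) by simp
      also have "f (x - f y) = f x - y" by (simp add: L.diff f(3))
      finally show ?thesis by (metis add_uminus_conv_diff norm_minus_commute)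
    qed
    then have "(\<integral>\<^sup>+y. indicator A x * indicator B (x - f y) \<partial>lborel) = (\<integral>\<^sup>+y. indicator A x * indicator {y. y + (- f x) \<in> B} y \<partial>lborel)"
      by (intro nn_integral_cong) (simp add: indicator_def B_def)
    also have "\<dots> = indicator A x * (\<integral>\<^sup>+y. indicator {y. y + (- f x) \<in> B} y \<partial>lborel)"
      by (rule nn_integral_cmult) measurable
    also have "(\<integral>\<^sup>+y. indicator {y. y + (- f x) \<in> B} y \<partial>lborel) = emeasure lborel {y. y + (- f x) \<in> B}"
      by (rule e) measurable
    also have "\<dots> = emeasure lborel B"
      by (rule emeasure_lborel_translate) measurable
    finally show ?thesis by (simp add: mult.commute)
  qed
  have "emeasure lborel {x. f x \<in> A} * emeasure lborel B = (\<integral>\<^sup>+x. emeasure lborel {x. f x \<in> A} * indicator B x \<partial>lborel)"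
    by (subst nn_integral_cmult) auto
  also have "\<dots> = (\<integral>\<^sup>+x. \<integral>\<^sup>+y. indicator B x * indicator A (x + f y) \<partial>lborel \<partial>lborel)"
    by (simp only: 1)
  also have "\<dots> = (\<integral>\<^sup>+y. \<integral>\<^sup>+x. indicator B x * indicator A (x + f y) \<partial>lborel \<partial>lborel)"
    by (rule lborel_pair.Fubini') measurable
  also have "\<dots> = (\<integral>\<^sup>+y. \<integral>\<^sup>+x. indicator A x * indicator B (x - f y) \<partial>lborel \<partial>lborel)"
    by (simp only: 2)
  also have "\<dots> = (\<integral>\<^sup>+x. \<integral>\<^sup>+y. indicator A x * indicator B (x - f y) \<partial>lborel \<partial>lborel)"
    by (rule lborel_pair.Fubini') measurable
  also have "\<dots> = (\<integral>\<^sup>+x. emeasure lborel B * indicator A x \<partial>lborel)"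
    by (simp only: 3)
  also have "\<dots> = emeasure lborel A * emeasure lborel B"
    by (subst nn_integral_cmult) (auto simp: mult.commute)
  finally have eq: "emeasure lborel {x. f x \<in> A} * emeasure lborel B = emeasure lborel A * emeasure lborel B" .
  have "emeasure lborel B \<noteq> top"
    using emeasure_bounded_finite[of B] by (auto simp: B_def)
  moreover have "emeasure lborel B \<noteq> 0"
    using content_ball_pos[of 1 "0 :: real^'d"] by (auto simp: B_def measure_def)
  ultimately show ?thesis
    using eq by (simp add: mult.commute[of _ "emeasure lborel B"] ennreal_mult_cancel_left)
qed

lemma reflect_norm:
  fixes a v :: "real^'d"
  shows "norm (reflect a v) = norm (v - a)" "norm (reflect a v - a) = norm v"
proof -
  define c where "c = 2 * (v \<bullet> a) / (a \<bullet> a) - 1"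
  have c: "reflect a v = v - c *\<^sub>R a"
    by (simp add: reflect_def c_def)
  \<comment> \<open>For \<open>a = 0\<close> both sides vanish.\<close>
  have k: "c * (a \<bullet> a) = 2 * (v \<bullet> a) - a \<bullet> a"
    by (simp add: c_def algebra_simps)
  have "(v - c *\<^sub>R a) \<bullet> (v - c *\<^sub>R a) = v \<bullet> v - 2 * c * (v \<bullet> a) + c * (c * (a \<bullet> a))"
    by (simp add: inner_diff inner_commute algebra_simps)
  also have "\<dots> = (v - a) \<bullet> (v - a)"
    unfolding k using k by (simp add: inner_diff inner_commute algebra_simps)
  finally show "norm (reflect a v) = norm (v - a)"
    by (simp add: c norm_eq)
  have "(v - c *\<^sub>R a - a) \<bullet> (v - c *\<^sub>R a - a) = v \<bullet> v - 2 * (c + 1) * (v \<bullet> a) + (c + 1) * (c * (a \<bullet> a) + a \<bullet> a)"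
    by (simp add: inner_diff inner_commute algebra_simps)
  also have "\<dots> = v \<bullet> v"
    unfolding k by (simp add: algebra_simps)
  finally show "norm (reflect a v - a) = norm v"
    by (simp add: c norm_eq)
qed

lemma lune_pair_reflect [simp]: "reflect a v \<in> lune_pair a \<longleftrightarrow> v \<in> lune_pair a"
  by (auto simp: lune_pair_def reflect_norm)

lemma lune_pair_bound: "v \<in> lune_pair a \<Longrightarrow> norm v \<le> 2 * norm a"
  using norm_triangle_ineq[of "v - a" a] norm_ge_zero[of a] by (auto simp: lune_pair_def simp del: norm_ge_zero)

lemma reflect_measurable [measurable (raw)]:
  assumes [measurable]: "f \<in> borel_measurable M" "g \<in> borel_measurable M"
  shows "(\<lambda>x. reflect (f x) (g x)) \<in> borel_measurable M"
  unfolding reflect_def by measurable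

lemma lune_swap_measurable [measurable (raw)]:
  assumes [measurable]: "f \<in> borel_measurable M" "g \<in> borel_measurable M"
  shows "(\<lambda>x. lune_swap (f x) (g x)) \<in> borel_measurable M"
  unfolding lune_swap_def lune_pair_def mem_Collect_eq by measurable

lemma torus_swap_measurable [measurable (raw)]:
  assumes [measurable]: "f \<in> borel_measurable M" "g \<in> borel_measurable M" "h \<in> borel_measurable M"
  shows "(\<lambda>x. torus_swap s (f x) (g x) (h x)) \<in> borel_measurable M"
  unfolding torus_swap_def by measurable

text \<open>Followed by the translation by \<open>- a\<close>, the reflection becomes a linear
  isometric involution: for \<open>a \<noteq> 0\<close>, the reflection in the hyperplane through
  \<open>0\<close> orthogonal to \<open>a\<close>.\<close>

lemma emeasure_reflect:
  assumes [measurable]: "A \<in> sets borel"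
  shows "emeasure lborel {v. reflect a v \<in> A} = emeasure lborel A"
proof -
  define f where "f v = reflect a v - a" for v
  have "emeasure lborel {v. reflect a v \<in> A} = emeasure lborel {v. f v \<in> {x. x + a \<in> A}}"
    by (simp add: f_def)
  also have "\<dots> = emeasure lborel {x. x + a \<in> A}"
  proof (rule emeasure_lborel_linear_involution)
    show "linear f"
      unfolding f_def reflect_def
      by (intro linearI) (simp_all add: inner_add_left algebra_simps add_divide_distrib)
    show "norm (f v) = norm v" for v
      by (simp add: f_def reflect_norm)
    show "f (f v) = v" for v
    proof (cases "a = 0")
      case False
      then have "a \<bullet> a \<noteq> 0" by simp
      have g: "f v = v - (2 * (v \<bullet> a) / (a \<bullet> a)) *\<^sub>R a" for v
        by (simp add: f_def reflect_def algebra_simps)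
      define c where "c = 2 * (v \<bullet> a) / (a \<bullet> a)"
      have "2 * ((v - c *\<^sub>R a) \<bullet> a) / (a \<bullet> a) = - c"
        using \<open>a \<bullet> a \<noteq> 0\<close> by (simp add: c_def inner_diff field_simps)
      then show ?thesis
        unfolding g c_def[symmetric] by simp
    qed (simp add: f_def reflect_def)
  qed measurable
  also have "\<dots> = emeasure lborel A"
    by (rule emeasure_lborel_translate) fact
  finally show ?thesis .
qed

lemma lune_pair_borel [measurable]: "lune_pair a \<in> sets borel"
  unfolding lune_pair_def by measurable

text \<open>The lunes reach at most \<open>2 * norm a < s / 2\<close> from the origin and so lie
  inside the centred cube. The map is a reflection on their union, which that reflection maps to
  itself, and the identity elsewhere.\<close>

lemma distr_lune_swap:
  fixes a :: "real^'d"
  assumes "s > 0" "norm a < s / 4"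
  shows "distr (torus_unif s (- (s/2))) (torus_unif s (- (s/2))) (lune_swap a) = torus_unif s (- (s/2))"
proof (rule measure_eqI)
  fix A assume "A \<in> sets (distr (torus_unif s (- (s/2))) (torus_unif s (- (s/2))) (lune_swap a))"
  then have A [measurable]: "A \<in> sets borel" by simp
  define C :: "(real^'d) set" where "C = half_open_box s (- (s/2))"
  have C [measurable]: "C \<in> sets borel" by (simp add: C_def)
  have m [measurable]: "{x. lune_swap a x \<in> A} \<in> sets borel" "{x. reflect a x \<in> A \<inter> lune_pair a} \<in> sets borel"
    by measurable
  have sub: "lune_pair a \<subseteq> C"
    using lune_pair_bound[of _ a] assms unfolding C_def by (intro subsetI small_in_box) fastforce
  have "emeasure lborel (C \<inter> {x. lune_swap a x \<in> A})
     = emeasure lborel ((C \<inter> A - lune_pair a) \<union> {x. reflect a x \<in> A \<inter> lune_pair a})"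
    using sub by (intro arg_cong[where f="emeasure lborel"]) (auto simp: lune_swap_def)
  also have "\<dots> = emeasure lborel (C \<inter> A - lune_pair a) + emeasure lborel {x. reflect a x \<in> A \<inter> lune_pair a}"
    by (rule plus_emeasure[symmetric]) auto
  also have "emeasure lborel {x. reflect a x \<in> A \<inter> lune_pair a} = emeasure lborel (A \<inter> lune_pair a)"
    by (rule emeasure_reflect) measurable
  also have "emeasure lborel (C \<inter> A - lune_pair a) + emeasure lborel (A \<inter> lune_pair a) =
    emeasure lborel ((C \<inter> A - lune_pair a) \<union> (A \<inter> lune_pair a))"
    by (rule plus_emeasure) auto
  also have "(C \<inter> A - lune_pair a) \<union> (A \<inter> lune_pair a) = C \<inter> A"
    using sub by auto
  finally show "emeasure (distr (torus_unif s (- (s/2))) (torus_unif s (- (s/2))) (lune_swap a)) A = emeasure (torus_unif s (- (s/2))) A"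
    by (subst emeasure_distr) (auto simp: torus_unif_def vimage_def C_def emeasure_half_open_box[OF assms(1)])
qed simp

lemma distr_torus_swap:
  fixes w u :: "real^'d"
  assumes "s > 0" "torus_norm s (u - w) < s / 4"
  shows "distr (torus_unif s 0) (torus_unif s 0) (torus_swap s w u) = torus_unif s 0"
proof -
  note sets_torus_unif [measurable_cong]
  let ?c = "- (s / 2)"
  let ?a = "centred s (u - w)"
  have "distr (torus_unif s 0) (torus_unif s 0) (torus_swap s w u) =
    distr (distr (distr (torus_unif s 0) (torus_unif s ?c) (\<lambda>x. wrap s ?c (x + (- w))))
      (torus_unif s ?c) (lune_swap ?a)) (torus_unif s 0) (\<lambda>x. wrap s 0 (x + w))"
    by (subst distr_distr; (subst distr_distr)?) (auto simp: comp_def torus_swap_def[abs_def])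
  also have "\<dots> = torus_unif s 0"
    using assms by (simp only: distr_wrap_shift distr_lune_swap torus_norm_def)
  finally show ?thesis .
qed

lemma torus_norm_measurable [measurable]: "torus_norm s \<in> borel_measurable borel"
  unfolding torus_norm_def by measurable

lemma measure_torus_ball:
  fixes x :: "real^'d"
  assumes "s > 0"
  shows "measure (torus_unif s 0) {y. torus_norm s (y - x) < \<rho>} =
    measure lborel (half_open_box s (- (s/2)) \<inter> {v :: real^'d. norm v < \<rho>}) / s ^ CARD('d)"
proof -
  note sets_torus_unif [measurable_cong]
  have [measurable]: "{v :: real^'d. norm v < \<rho>} \<in> sets borel"
    by measurable
  have "measure (torus_unif s 0) {y. torus_norm s (y - x) < \<rho>} =
    measure (distr (torus_unif s 0) (torus_unif s (- (s/2))) (\<lambda>y. centred s (y + (- x)))) {v. norm v < \<rho>}"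
    by (subst measure_distr) (auto simp: torus_norm_def vimage_def)
  also have "\<dots> = measure (torus_unif s (- (s/2))) {v :: real^'d. norm v < \<rho>}"
    using distr_wrap_shift[OF assms] by metis
  also have "\<dots> = measure lborel (half_open_box s (- (s/2)) \<inter> {v :: real^'d. norm v < \<rho>}) / s ^ CARD('d)"
    unfolding torus_unif_def using assms
    by (subst measure_uniform_measure) (simp_all add: emeasure_half_open_box measure_def)
  finally show ?thesis .
qed

lemma torus_ball_upper:
  fixes x :: "real^'d"
  assumes "s > 0" "\<rho> \<ge> 0"
  shows "measure (torus_unif s 0) {y. torus_norm s (y - x) < \<rho>} \<le> (2 * \<rho> / s) ^ CARD('d)"
proof -
  define S where "S = half_open_box s (- (s/2)) \<inter> {v :: real^'d. norm v < \<rho>}"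
  have "S \<subseteq> cbox (\<chi> i. -\<rho>) (\<chi> i. \<rho>)"
  proof
    fix v assume "v \<in> S"
    then have "\<bar>v $ i\<bar> \<le> \<rho>" for i
      using component_le_norm_cart[of v i] by (simp add: S_def)
    then show "v \<in> cbox (\<chi> i. -\<rho>) (\<chi> i. \<rho>)"
      by (simp add: mem_box_cart) (metis abs_le_iff minus_le_iff)
  qed
  then have "emeasure lborel S \<le> ennreal ((2 * \<rho>) ^ CARD('d))"
    using emeasure_mono[of S "cbox (\<chi> i. -\<rho>) (\<chi> i. \<rho>)" lborel] assms
    by (simp add: emeasure_lborel_cube)
  then have "measure lborel S \<le> (2 * \<rho>) ^ CARD('d)"
    using assms by (simp add: measure_def enn2real_leI)
  then show ?thesis
    unfolding measure_torus_ball[OF assms(1)] S_def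
    using assms by (simp add: power_divide divide_right_mono)
qed

lemma torus_ball_lower:
  fixes x :: "real^'d" and s :: real
  assumes "s > 0" "\<rho> > 0" "\<rho> \<le> s / 2"
  shows "(\<rho> / (CARD('d) * s)) ^ CARD('d) \<le> measure (torus_unif s 0) {y. torus_norm s (y - x) < \<rho>}"
proof -
  define S where "S = half_open_box s (- (s/2)) \<inter> {v :: real^'d. norm v < \<rho>}"
  \<comment> \<open>A vector with coordinates at most \<open>t\<close> in absolute value has l1 norm
    at most \<open>\<rho> / 2\<close>, which makes the bound on its norm strict. The cube of side
    \<open>2 * t = \<rho> / CARD('d)\<close> has the stated volume.\<close>
  define t where "t = \<rho> / (2 * CARD('d))"
  have t: "t > 0"
    using assms by (simp add: t_def)
  have [measurable]: "{v :: real^'d. norm v < \<rho>} \<in> sets borel"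
    by measurable
  have S: "S \<in> sets lborel" by (simp add: S_def)
  have "cbox (\<chi> i. -t) (\<chi> i. t) \<subseteq> S"
  proof
    fix v :: "real^'d" assume "v \<in> cbox (\<chi> i. -t) (\<chi> i. t)"
    then have "\<bar>v $ i\<bar> \<le> t" for i
      by (simp add: mem_box_cart abs_le_iff) (metis minus_le_iff)
    then have "norm v \<le> CARD('d) * t"
      using norm_le_l1_cart[of v] sum_bounded_above[of UNIV "\<lambda>i. \<bar>v $ i\<bar>" t] by simp
    also have "\<dots> = \<rho> / 2" by (simp add: t_def)
    finally have "norm v < \<rho>" using assms by simp
    then show "v \<in> S"
      using assms small_in_box[of v s] by (simp add: S_def)
  qed
  then have "emeasure lborel (cbox (\<chi> i. -t) (\<chi> i. t) :: (real^'d) set) \<le> emeasure lborel S"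
    using S by (rule emeasure_mono)
  then have "ennreal ((2 * t) ^ CARD('d)) \<le> emeasure lborel S"
    using t by (simp add: emeasure_lborel_cube)
  moreover have "emeasure lborel S \<le> emeasure lborel (half_open_box s (- (s/2)) :: (real^'d) set)"
    by (intro emeasure_mono) (auto simp: S_def)
  then have "emeasure lborel S < top"
    by (rule le_less_trans) (simp add: emeasure_half_open_box[OF assms(1)])
  then have "emeasure lborel S = ennreal (measure lborel S)"
    by (intro emeasure_eq_ennreal_measure) auto
  ultimately have "(2 * t) ^ CARD('d) \<le> measure lborel S"
    by (simp add: ennreal_le_iff)
  then have "(2 * t) ^ CARD('d) / s ^ CARD('d) \<le> measure lborel S / s ^ CARD('d)"
    using assms by (intro divide_right_mono) auto
  moreover have "(2 * t) ^ CARD('d) / s ^ CARD('d) = (\<rho> / (CARD('d) * s)) ^ CARD('d)"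
    unfolding power_divide[symmetric] by (simp add: t_def)
  ultimately show ?thesis
    unfolding measure_torus_ball[OF assms(1)] S_def by simp
qed

lemma null_sets_bisector:
  fixes p q :: "real^'d"
  assumes "p \<noteq> q"
  shows "{y. norm (y - p) = norm (y - q)} \<in> null_sets lborel"
proof -
  have "{y. norm (y - p) = norm (y - q)} = {y. (2 *\<^sub>R (p - q)) \<bullet> y = p \<bullet> p - q \<bullet> q}"
    by (auto simp: norm_eq inner_diff inner_commute algebra_simps)
  also have "negligible \<dots>"
    using assms by (intro negligible_hyperplane) auto
  finally have "emeasure lebesgue {y. norm (y - p) = norm (y - q)} = 0"
    by (simp add: negligible_iff_null_sets null_sets_def)
  moreover have "{y. norm (y - p) = norm (y - q)} \<in> sets borel"
    by measurable
  ultimately show ?thesis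
    by (simp add: null_sets_def)
qed

text \<open>A tie on the torus is a Euclidean tie between a lattice translate of \<open>u\<close>
  and one of \<open>w\<close>. Such translates never coincide, so ties are confined to countably
  many bisecting hyperplanes.\<close>

lemma torus_tie_null:
  fixes u w :: "real^'d"
  assumes "s > 0" "torus_norm s (u - w) \<noteq> 0"
  shows "measure (torus_unif s 0) {y. torus_norm s (y - u) = torus_norm s (y - w)} = 0"
proof -
  define T where "T = {y. torus_norm s (y - u) = torus_norm s (y - w)}"
  define N where "N kl = {y. norm (y - (u - lattice_vec s (fst kl))) = norm (y - (w - lattice_vec s (snd kl)))}" for kl
  have N: "N kl \<in> null_sets lborel" for kl
  proof -
    have "u - lattice_vec s (fst kl) \<noteq> w - lattice_vec s (snd kl)"
    proof
      assume "u - lattice_vec s (fst kl) = w - lattice_vec s (snd kl)"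
      then have "u - w + lattice_vec s (snd kl - fst kl) = 0"
        using lattice_vec_add[of s "fst kl" "snd kl - fst kl"] by (simp add: algebra_simps)
      then have "torus_norm s (u - w) \<le> 0"
        using torus_norm_le[OF assms(1), of "u - w" "snd kl - fst kl"] by simp
      then show False
        using assms(2) by (simp add: torus_norm_def)
    qed
    then show ?thesis
      unfolding N_def by (rule null_sets_bisector)
  qed
  have "T \<subseteq> (\<Union>kl. N kl)"
  proof
    fix y assume y: "y \<in> T"
    obtain k l where "centred s (y - u) = y - u + lattice_vec s k" "centred s (y - w) = y - w + lattice_vec s l"
      using wrap_lattice by metis
    with y have "y \<in> N (k, l)"
      by (simp add: T_def N_def torus_norm_def algebra_simps)
    then show "y \<in> (\<Union>kl. N kl)" by blast
  qed
  moreover have "(\<Union>kl. N kl) \<in> null_sets lborel"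
    using N by (intro null_sets_UN) auto
  moreover have T: "T \<in> sets borel"
    unfolding T_def by measurable
  ultimately have "T \<in> null_sets lborel"
    using null_sets_subset[of "\<Union>kl. N kl" lborel T] by auto
  then have "emeasure lborel (half_open_box s 0 \<inter> T) = 0"
    using emeasure_mono[of "half_open_box s 0 \<inter> T" T lborel] T by (auto simp: null_sets_def)
  then show ?thesis
    unfolding T_def[symmetric] torus_unif_def
    using assms(1) T by (subst measure_uniform_measure) (simp_all add: emeasure_half_open_box measure_def)
qed

section \<open>How the exchange of the lunes changes distances\<close>

lemma torus_swap_eq:
  "s > 0 \<Longrightarrow> torus_norm s (y - torus_swap s w u x) =
    torus_norm s (y - w - lune_swap (centred s (u - w)) (centred s (x - w)))"
  by (simp add: torus_swap_def torus_norm_wrap algebra_simps)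

text \<open>The two vectors agree modulo the lattice. The right-hand side can be larger, since a
  difference of centred representatives may leave the centred cube.\<close>

lemma torus_norm_diff_le:
  assumes "s > 0"
  shows "torus_norm s (x - u) \<le> norm (centred s (x - w) - centred s (u - w))"
proof -
  have "torus_norm s (centred s (x - w) - centred s (u - w)) = torus_norm s (x - w - (u - w))"
    using assms(1) by (simp only: torus_norm_wrap)
  then show ?thesis
    using torus_norm_le_norm[OF assms, of "centred s (x - w) - centred s (u - w)"] by simp
qed

text \<open>The point \<open>x\<close> lies outside the closed ball around \<open>u\<close> through
  \<open>w\<close>. If it is in the ball around \<open>w\<close>, then it is in the lune at
  \<open>w\<close> and is reflected out of that ball; otherwise it stays put. So the empty ball
  passes from \<open>u\<close> to \<open>w\<close>.\<close>

lemma torus_swap_avoids: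
  assumes "s > 0" "torus_norm s (u - w) < s / 8" "torus_norm s (u - w) < torus_norm s (x - u)"
  shows "torus_norm s (u - w) < torus_norm s (torus_swap s w u x - w)"
proof -
  define a where "a = centred s (u - w)"
  define v where "v = centred s (x - w)"
  have a: "torus_norm s (u - w) = norm a"
    by (simp add: a_def torus_norm_def)
  have n: "torus_norm s (torus_swap s w u x - w) = torus_norm s (lune_swap a v)"
    using assms(1) by (simp add: torus_swap_def torus_norm_wrap a_def v_def)
  have "torus_norm s (x - u) \<le> norm (v - a)"
    using torus_norm_diff_le[OF assms(1)] by (simp add: a_def v_def)
  then have va: "norm a < norm (v - a)"
    using assms(3) a by simp
  show ?thesis
  proof (cases "norm v \<le> norm a")
    case True
    then have "lune_swap a v = reflect a v" using va by (simp add: lune_swap_def lune_pair_def)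
    \<comment> \<open>The norm is at most \<open>2 * norm a < s / 4\<close>; below half the side,
      Euclidean and torus norms agree.\<close>
    moreover have "norm (v - a) < s / 2"
      using norm_triangle_ineq4[of v a] True assms(1,2) a by simp
    ultimately show ?thesis
      using va torus_norm_eq[OF assms(1), of "reflect a v"] by (simp add: n a reflect_norm)
  next
    case False
    then have "lune_swap a v = v"
      using va by (simp add: lune_swap_def lune_pair_def)
    moreover have "torus_norm s v = norm v"
      using assms(1) by (simp add: torus_norm_def v_def wrap_id wrap_in_box)
    ultimately show ?thesis
      using False by (simp add: n a)
  qed
qed

text \<open>
  A swapped point was on the side of \<open>w\<close> of the bisector of \<open>w\<close> and \<open>u\<close>, hence is moved away from
  every \<open>y\<close> on that side.
\<close>

lemma reflect_farther:
  fixes t v a :: "real^'d"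
  assumes "norm v < norm (v - a)" "norm t < norm (t - a)"
  shows "norm (t - v) \<le> norm (t - reflect a v)"
proof -
  have v: "2 * (v \<bullet> a) < a \<bullet> a" and t: "2 * (t \<bullet> a) < a \<bullet> a"
    using assms by (simp_all add: norm_lt inner_diff inner_commute)
  then have "0 < a \<bullet> a"
    by (metis inner_gt_zero_iff inner_zero_right mult_zero_right less_irrefl)
  define c where "c = 2 * (v \<bullet> a) / (a \<bullet> a) - 1"
  have k: "c * (a \<bullet> a) = 2 * (v \<bullet> a) - a \<bullet> a"
    using \<open>0 < a \<bullet> a\<close> by (simp add: c_def field_simps)
  have "c \<le> 0"
    using v \<open>0 < a \<bullet> a\<close> by (simp add: c_def field_simps)
  have "(t - (v - c *\<^sub>R a)) \<bullet> (t - (v - c *\<^sub>R a)) = (t - v) \<bullet> (t - v) + c * (2 * (t \<bullet> a) - 2 * (v \<bullet> a) + c * (a \<bullet> a))"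
    by (simp add: inner_diff inner_commute algebra_simps)
  also have "\<dots> = (t - v) \<bullet> (t - v) + c * (2 * (t \<bullet> a) - a \<bullet> a)"
    unfolding k by simp
  also have "\<dots> \<ge> (t - v) \<bullet> (t - v)"
    using \<open>c \<le> 0\<close> t by (simp add: mult_nonpos_nonpos)
  finally show ?thesis
    by (simp add: norm_le reflect_def c_def)
qed

lemma torus_swap_farther:
  assumes "s > 0" "torus_norm s (u - w) < s / 8" "torus_norm s (u - w) < torus_norm s (x - u)"
    and "torus_norm s (y - w) < s / 8" "torus_norm s (y - w) < torus_norm s (y - u)"
    and "torus_norm s (y - w) < torus_norm s (y - x)"
  shows "torus_norm s (y - w) < torus_norm s (y - torus_swap s w u x)"
proof -
  define a where "a = centred s (u - w)"
  define v where "v = centred s (x - w)"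
  define t where "t = centred s (y - w)"
  have a: "torus_norm s (u - w) = norm a" and t: "torus_norm s (y - w) = norm t"
    by (simp_all add: a_def t_def torus_norm_def)
  have n: "torus_norm s (y - torus_swap s w u x) = torus_norm s (t - lune_swap a v)"
    using assms(1) by (simp add: torus_swap_eq t_def a_def v_def torus_norm_wrap)
  have tv: "torus_norm s (y - x) = torus_norm s (t - v)"
    using assms(1) by (simp add: t_def v_def torus_norm_wrap)
  show ?thesis
  proof (cases "v \<in> lune_pair a")
    case False
    then show ?thesis
      using assms(6) by (simp add: n tv lune_swap_def)
  next
    case True
    have "torus_norm s (x - u) \<le> norm (v - a)"
      using torus_norm_diff_le[OF assms(1)] by (simp add: a_def v_def)
    then have va: "norm v \<le> norm a" "norm a < norm (v - a)"
      using True assms(3) a by (auto simp: lune_pair_def)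
    have "torus_norm s (y - u) \<le> norm (t - a)"
      using torus_norm_diff_le[OF assms(1)] by (simp add: a_def t_def)
    then have ta: "norm t < norm (t - a)"
      using assms(5) t by simp
    have "norm (reflect a v) \<le> norm v + norm a"
      by (simp add: reflect_norm norm_triangle_ineq4)
    then have small: "norm (t - reflect a v) < s / 2"
      using norm_triangle_ineq4[of t "reflect a v"] va(1) assms(1,2,4) a t by simp
    have "norm t < torus_norm s (t - v)"
      using assms(6) t tv by simp
    also have "\<dots> \<le> norm (t - v)"
      by (rule torus_norm_le_norm[OF assms(1)])
    also have "\<dots> \<le> norm (t - reflect a v)"
      using va ta by (intro reflect_farther) auto
    also have "\<dots> = torus_norm s (t - reflect a v)"
      using torus_norm_eq[OF assms(1) small] by simp
    finally show ?thesis
      using True by (simp add: n t lune_swap_def)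
  qed
qed

subsection \<open>Uniform points on the torus\<close>

text \<open>The side \<open>s\<close> is a free parameter, as radii enter the estimates only
  relative to \<open>s\<close>; the side is tied to \<open>n\<close> when the stated model is
  identified with this one. \<open>dim\<close> fixes the type that carries the dimension.\<close>

locale torus_sample =
  fixes s :: real and n :: nat and dim :: "'d::finite itself"
  assumes s_pos: "s > 0"
begin

abbreviation N :: "(real^'d) measure" where
  "N \<equiv> torus_unif s 0"

abbreviation \<Omega> :: "(nat \<Rightarrow> real^'d) measure" where
  "\<Omega> \<equiv> PiM {..<n} (\<lambda>_. N)"

section \<open>The parent map and childless vertices\<close>

definition D :: "(nat \<Rightarrow> real^'d) \<Rightarrow> nat \<Rightarrow> nat \<Rightarrow> real" where
  "D X i j = torus_norm s (X i - X j)"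

definition par :: "(nat \<Rightarrow> real^'d) \<Rightarrow> nat \<Rightarrow> nat" where
  "par X i = (LEAST j. j < i \<and> (\<forall>k<i. D X i j \<le> D X i k))"

text \<open>The condition \<open>v < k\<close> keeps out vertex \<open>0\<close>, whose
  \<open>par\<close> is a \<open>LEAST\<close> over an empty set.\<close>

definition children :: "(nat \<Rightarrow> real^'d) \<Rightarrow> nat \<Rightarrow> nat set" where
  "children X v = {k. v < k \<and> k < n \<and> par X k = v}"

definition childless :: "(nat \<Rightarrow> real^'d) \<Rightarrow> nat" where
  "childless X = card {v. v < n \<and> children X v = {}}"

sublocale prob_space \<Omega>
  by (intro prob_space_PiM prob_space_torus_unif s_pos)

lemma prob_space_N: "prob_space N"
  by (intro prob_space_torus_unif s_pos)

text \<open>Coordinates from \<open>n\<close> on are constant, because the product space consists of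
  extensional functions. Measurability proofs are thereby free of side conditions on
  indices.\<close>

lemma point_measurable [measurable]: "(\<lambda>X. X i) \<in> borel_measurable \<Omega>"
proof (cases "i < n")
  case True
  then have "(\<lambda>X. X i) \<in> measurable \<Omega> N"
    by (intro measurable_component_singleton) simp
  then show ?thesis
    by (simp cong: measurable_cong_sets)
next
  case False
  then have "(\<lambda>X. X i) \<in> borel_measurable \<Omega> \<longleftrightarrow> (\<lambda>X. undefined :: real^'d) \<in> borel_measurable \<Omega>"
    by (intro measurable_cong) (auto simp: space_PiM PiE_def extensional_def)
  then show ?thesis by simp
qed

lemma D_measurable [measurable]: "(\<lambda>X. D X i j) \<in> borel_measurable \<Omega>"
  unfolding D_def by measurable

lemma D_sym: "D X i j = D X j i"
  using torus_norm_minus[OF s_pos, of "X i - X j"] by (simp add: D_def)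

lemma par_measurable [measurable]: "(\<lambda>X. par X i) \<in> measurable \<Omega> (count_space UNIV)"
  unfolding par_def by measurable

text \<open>The third part is the tie rule: the oldest nearest vertex wins, so anything older than
  the parent is strictly farther. It makes every parent a strict record, whose probability can be
  bounded without discarding ties.\<close>

lemma par_props:
  assumes "k > 0"
  shows "par X k < k" "\<And>l. l < k \<Longrightarrow> D X k (par X k) \<le> D X k l" "\<And>l. l < par X k \<Longrightarrow> D X k (par X k) < D X k l"
proof -
  have fin: "finite (D X k ` {..<k})" "D X k ` {..<k} \<noteq> {}"
    using assms by auto
  from Min_in[OF this] obtain j where j: "j < k" "D X k j = Min (D X k ` {..<k})"
    by auto
  have "j < k \<and> (\<forall>l<k. D X k j \<le> D X k l)"
    using j fin by simp
  then have P: "par X k < k \<and> (\<forall>l<k. D X k (par X k) \<le> D X k l)"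
    unfolding par_def by (rule LeastI)
  then show "par X k < k" and le: "\<And>l. l < k \<Longrightarrow> D X k (par X k) \<le> D X k l"
    by auto
  fix l assume l: "l < par X k"
  have "\<not> (l < k \<and> (\<forall>m<k. D X k l \<le> D X k m))"
    using not_less_Least[OF l[unfolded par_def]] .
  then obtain m where "m < k" "D X k m < D X k l"
    using l P by force
  then show "D X k (par X k) < D X k l"
    using le by (meson le_less_trans)
qed

lemma par_eqI:
  assumes "j < k" "\<And>l. l < k \<Longrightarrow> l \<noteq> j \<Longrightarrow> D X k j < D X k l"
  shows "par X k = j"
proof (rule ccontr)
  assume "par X k \<noteq> j"
  then have "D X k j < D X k (par X k)"
    using assms(2)[of "par X k"] par_props(1)[of k X] assms(1) by auto
  then show False
    using par_props(2)[of k j X] assms(1) by auto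
qed

text \<open>If \<open>i\<close> is neither the old nor the new parent, both parents compete at
  unchanged distances and each is at least as near as the other. The strict part of the tie rule
  then excludes that one is older.\<close>

lemma par_upd:
  assumes "k \<noteq> i" "par X k \<noteq> i" "par (X(i := y)) k \<noteq> i" "k > 0"
  shows "par X k = par (X(i := y)) k"
proof -
  let ?Y = "X(i := y)"
  have e: "D ?Y k l = D X k l" if "l \<noteq> i" for l
    using that assms(1) by (simp add: D_def)
  have le: "D X k (par X k) \<le> D X k (par ?Y k)" "D ?Y k (par ?Y k) \<le> D ?Y k (par X k)"
    using assms(4) by (auto intro!: par_props)
  have a: "\<not> par X k < par ?Y k"
    using par_props(3)[OF assms(4), of "par X k" ?Y] le e assms by auto
  have b: "\<not> par ?Y k < par X k"
    using par_props(3)[OF assms(4), of "par ?Y k" X] le e assms by auto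
  from a b show ?thesis by (metis linorder_neqE_nat)
qed

lemma finite_children [simp]: "finite (children X v)"
  by (rule finite_subset[of _ "{..<n}"]) (auto simp: children_def)

lemma children_range: "v < n \<Longrightarrow> children X v \<noteq> {} \<longleftrightarrow> v \<in> par X ` {1..<n}"
proof
  assume "children X v \<noteq> {}"
  then show "v \<in> par X ` {1..<n}"
    by (force simp: children_def)
next
  assume "v \<in> par X ` {1..<n}"
  then obtain k where "1 \<le> k" "k < n" "v = par X k"
    by auto
  then show "children X v \<noteq> {}"
    using par_props(1)[of k X] by (auto simp: children_def)
qed

lemma par_range_sub: "par X ` {1..<n} \<subseteq> {..<n}"
proof (rule image_subsetI)
  fix k assume "k \<in> {1..<n}"
  then show "par X k \<in> {..<n}"
    using par_props(1)[of k X] by simp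
qed

lemma childless_eq: "real (childless X) = real n - real (card (par X ` {1..<n}))"
proof -
  have "{v. v < n \<and> children X v = {}} = {..<n} - par X ` {1..<n}"
    using children_range by auto
  then have "childless X = n - card (par X ` {1..<n})"
    unfolding childless_def using par_range_sub[of X] by (simp add: card_Diff_subset)
  moreover have "card (par X ` {1..<n}) \<le> n"
    using card_mono[OF _ par_range_sub[of X]] by simp
  ultimately show ?thesis by simp
qed

text \<open>Apart from \<open>i\<close> itself, a vertex changes its parent only if it is a child of
  \<open>i\<close> before or after the move.\<close>

lemma childless_upd:
  fixes y :: "real^'d"
  defines "Y X i \<equiv> X(i := y)"
  shows "\<bar>real (childless X) - real (childless (Y X i))\<bar> \<le> 1 + real (card (children X i)) + real (card (children (Y X i) i))"
proof -
  let ?B = "insert i (children X i \<union> children (Y X i) i)"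
  have "\<bar>real (card (par X ` {1..<n})) - real (card (par (Y X i) ` {1..<n}))\<bar> \<le> real (card ?B)"
  proof (rule card_image_diff_le)
    fix k assume k: "k \<in> {1..<n}" "k \<notin> ?B"
    have "k > 0" "k < n" "k \<noteq> i"
      using k by auto
    moreover have "par Z k \<noteq> i" if "k \<notin> children Z i" for Z
      using that par_props(1)[OF \<open>k > 0\<close>, of Z] \<open>k < n\<close> unfolding children_def by blast
    ultimately show "par X k = par (Y X i) k"
      using k(2) unfolding Y_def by (intro par_upd) blast+
  qed simp_all
  moreover have "card ?B \<le> 1 + card (children X i) + card (children (Y X i) i)"
    using card_Un_le[of "children X i" "children (Y X i) i"] card_insert_le_m1
    by (simp add: card_insert_if)
  ultimately show ?thesis
    unfolding childless_eq by linarith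
qed

lemma children_card: "card (children X v) = (\<Sum>k<n. of_bool (v < k \<and> par X k = v))"
proof -
  have "children X v = {k \<in> {..<n}. v < k \<and> par X k = v}"
    by (auto simp: children_def)
  then show ?thesis
    by (simp only: card_eq_sum of_bool_def sum.inter_filter[OF finite_lessThan])
qed

lemma childless_sum: "real (childless X) = (\<Sum>v<n. of_bool (children X v = {}))"
proof -
  have "{v. v < n \<and> children X v = {}} = {v \<in> {..<n}. children X v = {}}"
    by auto
  then have "childless X = (\<Sum>v<n. of_bool (children X v = {}))"
    by (simp only: childless_def card_eq_sum of_bool_def sum.inter_filter[OF finite_lessThan])
  then show ?thesis
    by simp
qed

lemma children_empty_iff: "children X v = {} \<longleftrightarrow> (\<forall>k<n. v < k \<longrightarrow> par X k \<noteq> v)"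
  by (auto simp: children_def)

lemma childless_measurable [measurable]: "(\<lambda>X. real (childless X)) \<in> borel_measurable \<Omega>"
  unfolding childless_sum children_empty_iff of_bool_def by measurable

lemma children_card_measurable [measurable]: "(\<lambda>X. real (card (children X v))) \<in> borel_measurable \<Omega>"
  unfolding children_card of_nat_sum of_bool_def by measurable

lemma childless_le: "childless X \<le> n"
  unfolding childless_def by (rule order_trans[OF card_mono[of "{..<n}"]]) auto

lemma children_le: "card (children X v) \<le> n"
  by (rule order_trans[OF card_mono[of "{..<n}"]]) (auto simp: children_def)

section \<open>Probabilities of distance events\<close>

abbreviation pr :: "((nat \<Rightarrow> real^'d) \<Rightarrow> bool) \<Rightarrow> real" where
  "pr P \<equiv> prob {X \<in> space \<Omega>. P X}"

lemma pr_mono: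
  assumes "\<And>X. X \<in> space \<Omega> \<Longrightarrow> P X \<Longrightarrow> Q X" "Measurable.pred \<Omega> Q"
  shows "pr P \<le> pr Q"
  using assms by (intro finite_measure_mono) auto

lemma pr_conj_le:
  assumes "i < n" "q \<ge> 0" "Measurable.pred \<Omega> P" "Measurable.pred \<Omega> Q"
    and "\<And>X y. P (X(i := y)) = P X"
    and "\<And>X. P X \<Longrightarrow> measure N {y. Q (X(i := y))} \<le> q"
  shows "pr (\<lambda>X. P X \<and> Q X) \<le> q * pr P"
  by (rule prob_PiM_conj_le[where i=i]) (use assms prob_space_N in auto)

text \<open>Given the position of \<open>j\<close>, the older points avoid the ball around it
  independently of each other. The induction integrates out one of them at a time.\<close>

lemma far_prob:
  assumes "j < n" "0 < \<rho>" "\<rho> \<le> s / 2"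
  shows "pr (\<lambda>X. \<forall>l<j. \<rho> \<le> D X j l) \<le> (1 - (\<rho> / (CARD('d) * s)) ^ CARD('d)) ^ j"
proof -
  interpret N: prob_space N by (rule prob_space_N)
  define q where "q = 1 - (\<rho> / (CARD('d) * s)) ^ CARD('d)"
  have ball: "1 - q \<le> measure N {y. torus_norm s (y - x) < \<rho>}" for x
    using torus_ball_lower[OF s_pos assms(2,3), of x] by (simp add: q_def)
  have "0 \<le> q"
    using ball[of 0] N.prob_le_1[of "{y. torus_norm s (y - 0) < \<rho>}"] by linarith
  have "pr (\<lambda>X. \<forall>l<m. \<rho> \<le> D X j l) \<le> q ^ m" if "m \<le> j" for m
    using that
  proof (induction m)
    case 0
    then show ?case by simp
  next
    case (Suc m)
    have "pr (\<lambda>X. \<forall>l<Suc m. \<rho> \<le> D X j l) = pr (\<lambda>X. (\<forall>l<m. \<rho> \<le> D X j l) \<and> \<rho> \<le> D X j m)"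
      by (simp add: All_less_Suc conj_commute)
    also have "\<dots> \<le> q * pr (\<lambda>X. \<forall>l<m. \<rho> \<le> D X j l)"
    proof (rule pr_conj_le[where i=m])
      fix X :: "nat \<Rightarrow> real^'d"
      have "measure N {y. \<rho> \<le> D (X(m := y)) j m} = measure N (space N - {y. torus_norm s (y - X j) < \<rho>})"
        using Suc.prems torus_norm_minus[OF s_pos, of "X j - _"]
        by (intro arg_cong[where f="measure N"]) (auto simp: D_def not_less)
      also have "\<dots> = 1 - measure N {y. torus_norm s (y - X j) < \<rho>}"
        by (rule N.prob_compl) simp
      also have "\<dots> \<le> q"
        using ball[of "X j"] by simp
      finally show "measure N {y. \<rho> \<le> D (X(m := y)) j m} \<le> q" .
    qed (use Suc.prems assms \<open>0 \<le> q\<close> in \<open>auto simp: D_def\<close>)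
    also have "\<dots> \<le> q * q ^ m"
      using Suc \<open>0 \<le> q\<close> by (intro mult_left_mono) auto
    finally show ?case by simp
  qed
  then show ?thesis
    by (simp add: q_def)
qed

text \<open>That \<open>i\<close> is a record for \<open>k\<close> involves only \<open>k\<close>
  and the vertices up to \<open>i\<close>, so it is independent of the position of \<open>j\<close>.
  It stands in for the event that \<open>i\<close> is the parent of \<open>k\<close>, which can
  depend on \<open>j\<close>.\<close>

lemma near_prob:
  assumes "i < k" "i < j" "j < n" "k \<noteq> j" "0 \<le> \<rho>"
  shows "pr (\<lambda>X. (\<forall>l<i. D X k i < D X k l) \<and> D X j i < \<rho>)
    \<le> (2 * \<rho> / s) ^ CARD('d) * pr (\<lambda>X. \<forall>l<i. D X k i < D X k l)"
proof (rule pr_conj_le[where i=j])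
  fix X :: "nat \<Rightarrow> real^'d" and y :: "real^'d"
  show "measure N {y. D (X(j := y)) j i < \<rho>} \<le> (2 * \<rho> / s) ^ CARD('d)"
    using assms torus_ball_upper[OF s_pos assms(5), of "X i"] by (simp add: D_def)
  have "D (X(j := y)) k l = D X k l" if "l \<le> i" for l
    using that assms by (simp add: D_def)
  then show "(\<forall>l<i. D (X(j := y)) k i < D (X(j := y)) k l) = (\<forall>l<i. D X k i < D X k l)"
    by simp
  show "0 \<le> (2 * \<rho> / s) ^ CARD('d)"
    using assms s_pos by simp
  show "Measurable.pred \<Omega> (\<lambda>X. \<forall>l<i. D X k i < D X k l)" "Measurable.pred \<Omega> (\<lambda>X. D X j i < \<rho>)"
    by measurable
qed (fact assms)

lemma measure_torus_point: "measure N {y. torus_norm s (y - x) = 0} = 0"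
proof -
  interpret N: prob_space N by (rule prob_space_N)
  have "measure N {y. torus_norm s (y - x) = 0} \<le> e" if "0 < e" for e
  proof -
    define r where "r = min e 1"
    have r: "0 < r" "r \<le> 1" "r \<le> e" using that by (auto simp: r_def)
    have "measure N {y. torus_norm s (y - x) = 0} \<le> measure N {y. torus_norm s (y - x) < s * r / 2}"
    proof (rule N.finite_measure_mono)
      show "{y. torus_norm s (y - x) = 0} \<subseteq> {y. torus_norm s (y - x) < s * r / 2}"
        using r s_pos by auto
      have "{y. torus_norm s (y - x) < s * r / 2} \<in> sets borel"
        by measurable
      then show "{y. torus_norm s (y - x) < s * r / 2} \<in> sets N"
        by simp
    qed
    also have "\<dots> \<le> (2 * (s * r / 2) / s) ^ CARD('d)"
      using r s_pos by (intro torus_ball_upper) auto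
    also have "\<dots> = r ^ CARD('d)"
      using s_pos by simp
    also have "\<dots> \<le> r ^ 1"
      using r by (intro power_decreasing) (auto simp: Suc_le_eq)
    finally show ?thesis using r by simp
  qed
  then have "measure N {y. torus_norm s (y - x) = 0} \<le> 0"
    by (rule dense_ge)
  then show ?thesis
    by (intro antisym measure_nonneg)
qed

text \<open>Bisectors are null only for distinct points, so the coincidence of \<open>a\<close> and
  \<open>b\<close> is split off and shown to be null separately.\<close>

lemma tie_prob_pair:
  assumes "a < j" "b < j" "a \<noteq> b" "j < n"
  shows "pr (\<lambda>X. D X j a = D X j b) = 0"
proof -
  have "pr (\<lambda>X. D X j a = D X j b) \<le> prob ({X \<in> space \<Omega>. D X a b \<noteq> 0 \<and> D X j a = D X j b} \<union> {X \<in> space \<Omega>. D X a b = 0})"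
    by (rule finite_measure_mono) auto
  also have "\<dots> \<le> pr (\<lambda>X. D X a b \<noteq> 0 \<and> D X j a = D X j b) + pr (\<lambda>X. D X a b = 0)"
    by (rule measure_Un_le) measurable
  also have "pr (\<lambda>X. D X a b \<noteq> 0 \<and> D X j a = D X j b) \<le> 0 * pr (\<lambda>X. D X a b \<noteq> 0)"
  proof (rule pr_conj_le[where i=j])
    fix X :: "nat \<Rightarrow> real^'d" and y :: "real^'d"
    show "measure N {y. D (X(j := y)) j a = D (X(j := y)) j b} \<le> 0" if "D X a b \<noteq> 0"
      using torus_tie_null[OF s_pos, of "X a" "X b"] assms that by (simp add: D_def)
    show "(D (X(j := y)) a b \<noteq> 0) = (D X a b \<noteq> 0)"
      using assms by (simp add: D_def)
    show "Measurable.pred \<Omega> (\<lambda>X. D X a b \<noteq> 0)" "Measurable.pred \<Omega> (\<lambda>X. D X j a = D X j b)"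
      by measurable
  qed (use assms in simp_all)
  also have "pr (\<lambda>X. D X a b = 0) \<le> pr (\<lambda>X. True \<and> D X a b = 0)"
    by simp
  also have "pr (\<lambda>X. True \<and> D X a b = 0) \<le> 0 * pr (\<lambda>X. True)"
  proof (rule pr_conj_le[where i=a])
    fix X :: "nat \<Rightarrow> real^'d"
    show "measure N {y. D (X(a := y)) a b = 0} \<le> 0"
      using measure_torus_point[of "X b"] assms by (simp add: D_def)
    show "Measurable.pred \<Omega> (\<lambda>X. D X a b = 0)"
      by measurable
  qed (use assms in simp_all)
  finally show ?thesis
    by (intro antisym measure_nonneg) simp
qed

lemma tie_prob:
  assumes "j < n"
  shows "pr (\<lambda>X. \<exists>a<j. \<exists>b<j. a \<noteq> b \<and> D X j a = D X j b) = 0"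
proof -
  have "finite {(a, b). a < j \<and> b < j \<and> a \<noteq> b}"
    by (rule finite_subset[of _ "{..<j} \<times> {..<j}"]) auto
  have "{X \<in> space \<Omega>. \<exists>a<j. \<exists>b<j. a \<noteq> b \<and> D X j a = D X j b} =
    (\<Union>ab\<in>{(a, b). a < j \<and> b < j \<and> a \<noteq> b}. {X \<in> space \<Omega>. D X j (fst ab) = D X j (snd ab)})"
    by auto blast
  then have "pr (\<lambda>X. \<exists>a<j. \<exists>b<j. a \<noteq> b \<and> D X j a = D X j b) =
    prob (\<Union>ab\<in>{(a, b). a < j \<and> b < j \<and> a \<noteq> b}. {X \<in> space \<Omega>. D X j (fst ab) = D X j (snd ab)})"
    by (rule arg_cong)
  also have "\<dots> \<le> (\<Sum>ab\<in>{(a, b). a < j \<and> b < j \<and> a \<noteq> b}. pr (\<lambda>X. D X j (fst ab) = D X j (snd ab)))"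
    by (rule finite_measure_subadditive_finite) (use \<open>finite _\<close> in auto)
  also have "\<dots> = 0"
    using assms by (intro sum.neutral) (auto intro!: tie_prob_pair)
  finally show ?thesis
    by (intro antisym measure_nonneg) simp
qed

section \<open>Exchangeability and records\<close>

definition swap_labels :: "nat \<Rightarrow> nat \<Rightarrow> (nat \<Rightarrow> real^'d) \<Rightarrow> nat \<Rightarrow> real^'d" where
  "swap_labels i j X = (\<lambda>m\<in>{..<n}. X (Transposition.transpose i j m))"

lemma D_swap_labels:
  "a < n \<Longrightarrow> b < n \<Longrightarrow> D (swap_labels i j X) a b = D X (Transposition.transpose i j a) (Transposition.transpose i j b)"
  by (simp add: D_def swap_labels_def)

lemma swap_labels_measurable:
  assumes "i < n" "j < n"
  shows "swap_labels i j \<in> measurable \<Omega> \<Omega>"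
  unfolding swap_labels_def
proof (rule measurable_restrict)
  have perm: "Transposition.transpose i j permutes {..<n}"
    using assms by (intro permutes_swap_id) auto
  fix m assume "m \<in> {..<n}"
  then have "Transposition.transpose i j m \<in> {..<n}"
    using perm permutes_in_image by metis
  then show "(\<lambda>X. X (Transposition.transpose i j m)) \<in> measurable \<Omega> N"
    by (rule measurable_component_singleton)
qed

lemma pr_swap_labels:
  assumes "i < n" "j < n" and [measurable]: "Measurable.pred \<Omega> P"
  shows "pr (\<lambda>X. P (swap_labels i j X)) = pr P"
proof -
  have perm: "Transposition.transpose i j permutes {..<n}"
    using assms by (intro permutes_swap_id) auto
  note m = swap_labels_measurable[OF assms(1,2)]
  have "pr P = measure (distr \<Omega> \<Omega> (swap_labels i j)) {X \<in> space \<Omega>. P X}"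
    using distr_PiM_permute[OF prob_space_N perm] by (simp add: swap_labels_def[abs_def])
  also have "\<dots> = prob (swap_labels i j -` {X \<in> space \<Omega>. P X} \<inter> space \<Omega>)"
    by (rule measure_distr[OF m]) measurable
  also have "swap_labels i j -` {X \<in> space \<Omega>. P X} \<inter> space \<Omega> = {X \<in> space \<Omega>. P (swap_labels i j X)}"
    using measurable_space[OF m] by auto
  finally show ?thesis by simp
qed

text \<open>Each of the vertices \<open>0, ..., i\<close> is equally likely to be the strictly
  nearest of them to \<open>k\<close>, since exchanging the labels \<open>m\<close> and
  \<open>i\<close> leaves \<open>k\<close> alone. These \<open>i + 1\<close> events are
  disjoint.\<close>

lemma record_prob:
  assumes "i < k" "k < n"
  shows "pr (\<lambda>X. \<forall>l<i. D X k i < D X k l) \<le> 1 / (real i + 1)"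
proof -
  define G where "G m X \<longleftrightarrow> (\<forall>l\<le>i. l \<noteq> m \<longrightarrow> D X k m < D X k l)" for m X
  have G_m [measurable]: "Measurable.pred \<Omega> (G m)" for m
    unfolding G_def by measurable
  have eq: "pr (G m) = pr (G i)" if m: "m \<le> i" for m
  proof -
    let ?t = "Transposition.transpose m i"
    have tk: "?t k = k" using m assms by (simp add: transpose_apply_other)
    have "G m (swap_labels m i X) \<longleftrightarrow> G i X" for X
    proof -
      have "G m (swap_labels m i X) \<longleftrightarrow> (\<forall>l\<le>i. l \<noteq> m \<longrightarrow> D X k i < D X k (?t l))"
        unfolding G_def using m assms by (auto simp: D_swap_labels tk)
      also have "\<dots> \<longleftrightarrow> G i X"
      proof
        assume *: "\<forall>l\<le>i. l \<noteq> m \<longrightarrow> D X k i < D X k (?t l)"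
        have "D X k i < D X k l" if "l \<le> i" "l \<noteq> i" for l
          using *[rule_format, of l] *[rule_format, of i] that by (cases "l = m") (auto simp: transpose_apply_other)
        then show "G i X" by (simp add: G_def)
      next
        assume *: "G i X"
        have "D X k i < D X k (?t l)" if "l \<le> i" "l \<noteq> m" for l
          using * that m by (cases "l = i") (auto simp: transpose_apply_other G_def)
        then show "\<forall>l\<le>i. l \<noteq> m \<longrightarrow> D X k i < D X k (?t l)" by simp
      qed
      finally show ?thesis .
    qed
    then show ?thesis
      using pr_swap_labels[of m i "G m"] m assms by simp
  qed
  have "(\<Sum>m\<le>i. pr (G m)) = prob (\<Union>m\<le>i. {X \<in> space \<Omega>. G m X})"
  proof (rule finite_measure_finite_Union[symmetric])
    show "disjoint_family_on (\<lambda>m. {X \<in> space \<Omega>. G m X}) {..i}"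
      unfolding disjoint_family_on_def
    proof (intro ballI impI equals0I)
      fix a b X assume "a \<in> {..i}" "b \<in> {..i}" "a \<noteq> b" "X \<in> {X \<in> space \<Omega>. G a X} \<inter> {X \<in> space \<Omega>. G b X}"
      then have "D X k a < D X k b" "D X k b < D X k a"
        by (auto simp: G_def)
      then show False by simp
    qed
  qed auto
  then have "(\<Sum>m\<le>i. pr (G m)) \<le> 1"
    by simp
  moreover have "(\<Sum>m\<le>i. pr (G m)) = (\<Sum>m\<le>i. pr (G i))"
    by (rule sum.cong) (auto intro: eq)
  ultimately have "(real i + 1) * pr (G i) \<le> 1"
    by (simp add: add.commute)
  then have "pr (G i) \<le> 1 / (real i + 1)"
    by (simp add: pos_le_divide_eq mult.commute)
  moreover have "pr (\<lambda>X. \<forall>l<i. D X k i < D X k l) \<le> pr (G i)"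
    by (rule pr_mono) (auto simp: G_def)
  ultimately show ?thesis
    by simp
qed

subsection \<open>The upper bound on the expectation\<close>

text \<open>A strict minimum, instead of \<open>par\<close>, makes the relation blind to the age of
  the competitors, so that it can be followed through relabelling and reflection. Ties cost only a
  null event.\<close>

definition short_child :: "(nat \<Rightarrow> real^'d) \<Rightarrow> nat \<Rightarrow> nat \<Rightarrow> bool" where
  "short_child X i j \<longleftrightarrow> i < j \<and> D X j i < s / 8 \<and> (\<forall>l<j. l \<noteq> i \<longrightarrow> D X j i < D X j l)"

text \<open>\<open>has_later X v v\<close> says that \<open>v\<close> has a short child at all. If
  \<open>j\<close> is a short child of \<open>i\<close>, then \<open>has_later X i j\<close> says
  that it is not the last one.\<close>

definition has_later :: "(nat \<Rightarrow> real^'d) \<Rightarrow> nat \<Rightarrow> nat \<Rightarrow> bool" where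
  "has_later X v j \<longleftrightarrow> (\<exists>k<n. j < k \<and> short_child X v k)"

lemma short_child_measurable [measurable]: "Measurable.pred \<Omega> (\<lambda>X. short_child X i j)"
  unfolding short_child_def by measurable

lemma has_later_measurable [measurable]: "Measurable.pred \<Omega> (\<lambda>X. has_later X i j)"
  unfolding has_later_def by measurable

text \<open>The length condition is part of the map: across a long edge nothing moves, so the law is
  preserved without conditioning on the edge being short. In use, \<open>S\<close> consists of the
  vertices older than \<open>j\<close> other than \<open>i\<close>.\<close>

definition reflect_points :: "nat \<Rightarrow> nat \<Rightarrow> nat set \<Rightarrow> (nat \<Rightarrow> real^'d) \<Rightarrow> nat \<Rightarrow> real^'d" where
  "reflect_points i j S X = (\<lambda>l. if l \<in> S \<and> D X j i < s / 8 then torus_swap s (X i) (X j) (X l) else X l)"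

text \<open>Points are moved one at a time. As \<open>i\<close> and \<open>j\<close> never move,
  every step uses the same mirror, and given the other points it is a measure-preserving map of a
  single coordinate.\<close>

lemma reflect_points_distr:
  assumes "finite S" "S \<subseteq> {..<n} - {i, j}"
  shows "reflect_points i j S \<in> measurable \<Omega> \<Omega> \<and> distr \<Omega> \<Omega> (reflect_points i j S) = \<Omega>"
  using assms
proof (induction S rule: finite_induct)
  case empty
  have "reflect_points i j {} = (\<lambda>X. X)"
    by (simp add: reflect_points_def[abs_def])
  then show ?case by (simp add: distr_id)
next
  case (insert l S)
  then have IH: "reflect_points i j S \<in> measurable \<Omega> \<Omega>" "distr \<Omega> \<Omega> (reflect_points i j S) = \<Omega>"
    and l: "l < n" "l \<noteq> i" "l \<noteq> j"
    by auto
  define T where "T Y = (if D Y j i < s / 8 then torus_swap s (Y i) (Y j) (Y l) else Y l)" for Y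
  define U where "U Y = Y(l := T Y)" for Y
  have "T \<in> borel_measurable \<Omega>"
    unfolding T_def by measurable
  then have T: "T \<in> measurable \<Omega> N"
    by (simp cong: measurable_cong_sets)
  then have U: "U \<in> measurable \<Omega> \<Omega>"
    unfolding U_def by (rule fun_upd_measurable[rotated 2]) (use l in auto)
  have dU: "distr \<Omega> \<Omega> U = \<Omega>"
    unfolding U_def
  proof (rule distr_PiM_update[OF prob_space_N _ _ T])
    fix X
    have "T (X(l := y)) = (if D X j i < s / 8 then torus_swap s (X i) (X j) y else y)" for y
      using l by (simp add: T_def D_def)
    moreover have "distr N N (\<lambda>y. if D X j i < s / 8 then torus_swap s (X i) (X j) y else y) = N"
      using distr_torus_swap[OF s_pos, of "X j" "X i"] s_pos
      by (cases "D X j i < s / 8") (simp_all add: D_def distr_id)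
    ultimately show "distr N N (\<lambda>y. T (X(l := y))) = N"
      by simp
  qed (use l in auto)
  have eq: "reflect_points i j (insert l S) = U \<circ> reflect_points i j S"
    using l insert.hyps insert.prems
    by (auto simp: fun_eq_iff reflect_points_def U_def T_def D_def)
  show ?case
    unfolding eq using distr_distr[OF U IH(1)] IH(2) dU
    by (intro conjI measurable_comp[OF IH(1) U]) metis
qed

text \<open>
  Let \<open>i\<close> be the nearest older vertex of \<open>j\<close>. Exchanging the labels turns the event that the ball
  around \<open>j\<close> through \<open>i\<close> is empty into the event that the ball around \<open>i\<close> through \<open>j\<close> is
  empty. Swapping the two lunes by reflection leads from one event to the other while it only
  removes competitors of \<open>i\<close>.
\<close>

lemma later_child_prob:
  assumes "i < j" "j < n"
  shows "pr (\<lambda>X. short_child X i j \<and> has_later X i j) \<le> pr (\<lambda>X. short_child X i j \<and> has_later X j j)"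
proof -
  define E where "E X \<longleftrightarrow> D X i j < s / 8 \<and> (\<forall>l<j. l \<noteq> i \<longrightarrow> D X i j < D X i l) \<and> has_later X i j" for X
  have E_m [measurable]: "Measurable.pred \<Omega> E"
    unfolding E_def by measurable
  define S where "S = {..<j} - {i}"
  have S: "finite S" "S \<subseteq> {..<n} - {i, j}"
    using assms by (auto simp: S_def)
  note fm = reflect_points_distr[OF S, THEN conjunct1]
  have "pr (\<lambda>X. short_child X i j \<and> has_later X i j) \<le> pr (\<lambda>X. E (reflect_points i j S X))"
  proof (rule pr_mono)
    fix X assume X: "short_child X i j \<and> has_later X i j"
    define Y where "Y = reflect_points i j S X"
    have r: "torus_norm s (X j - X i) < s / 8" and r': "\<And>l. l \<in> S \<Longrightarrow> torus_norm s (X j - X i) < torus_norm s (X l - X j)"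
      using X D_sym[of X j] by (auto simp: short_child_def S_def D_def)
    have Y: "Y i = X i" "Y j = X j" "\<And>l. l \<ge> j \<Longrightarrow> Y l = X l"
      "\<And>l. l \<in> S \<Longrightarrow> Y l = torus_swap s (X i) (X j) (X l)"
      using r by (auto simp: Y_def reflect_points_def S_def D_def)
    have "D Y i j < D Y i l" if "l < j" "l \<noteq> i" for l
    proof -
      have "l \<in> S" using that by (simp add: S_def)
      then have "torus_norm s (X j - X i) < torus_norm s (Y l - X i)"
        using torus_swap_avoids[OF s_pos r r'] Y by simp
      then show ?thesis
        using D_sym[of Y i l] D_sym[of Y i j] Y by (simp add: D_def)
    qed
    moreover have "D Y i j < s / 8"
      using r Y D_sym[of Y i j] by (simp add: D_def)
    moreover have "has_later Y i j"
    proof -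
      obtain k where k: "k < n" "j < k" "short_child X i k"
        using X by (auto simp: has_later_def)
      have "D Y k i < D Y k l" if "l < k" "l \<noteq> i" for l
      proof (cases "l \<in> S")
        case True
        then have "torus_norm s (X k - X i) < torus_norm s (X k - torus_swap s (X i) (X j) (X l))"
          using k that assms by (intro torus_swap_farther[OF s_pos r r']) (auto simp: short_child_def D_def)
        then show ?thesis
          using True Y k by (simp add: D_def)
      next
        case False
        then have "l \<ge> j" using that by (auto simp: S_def)
        then show ?thesis
          using k that Y by (auto simp: D_def short_child_def)
      qed
      then have "short_child Y i k"
        using k assms Y by (auto simp: short_child_def D_def)
      then show ?thesis
        using k by (auto simp: has_later_def)
    qed
    ultimately show "E (reflect_points i j S X)"
      by (simp add: E_def Y_def)
  qed (rule measurable_compose[OF fm E_m])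
  also have "\<dots> = measure (distr \<Omega> \<Omega> (reflect_points i j S)) {X \<in> space \<Omega>. E X}"
    by (subst measure_distr[OF fm]) (auto intro!: arg_cong[where f=prob] dest: measurable_space[OF fm])
  also have "\<dots> = pr E"
    using reflect_points_distr[OF S] by simp
  also have "\<dots> \<le> pr (\<lambda>X. short_child (swap_labels i j X) i j \<and> has_later (swap_labels i j X) j j)"
  proof (rule pr_mono)
    let ?t = "Transposition.transpose i j"
    fix X assume E: "E X"
    define Y where "Y = swap_labels i j X"
    have D: "D Y a b = D X (?t a) (?t b)" if "a < n" "b < n" for a b
      unfolding Y_def using that by (rule D_swap_labels)
    have "D Y j i = D X i j"
      using assms by (simp add: D)
    moreover have "D Y j l = D X i l" if "l < j" "l \<noteq> i" for l
      using that assms by (simp add: D transpose_apply_other)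
    ultimately have "short_child Y i j"
      using E assms by (simp add: E_def short_child_def)
    moreover have "has_later Y j j"
    proof -
      obtain k where k: "k < n" "j < k" "short_child X i k"
        using E by (auto simp: has_later_def E_def)
      have "D Y k j = D X k i"
        using k assms by (simp add: D transpose_apply_other)
      moreover have "D X k i < D Y k l" if "l < k" "l \<noteq> j" for l
      proof (cases "l = i")
        case True
        then show ?thesis
          using k assms by (simp add: D transpose_apply_other short_child_def)
      next
        case False
        then show ?thesis
          using k assms that by (simp add: D transpose_apply_other short_child_def)
      qed
      ultimately have "short_child Y j k"
        using k by (simp add: short_child_def)
      then show ?thesis
        using k by (auto simp: has_later_def)
    qed
    ultimately show "short_child (swap_labels i j X) i j \<and> has_later (swap_labels i j X) j j"
      by (simp add: Y_def)
  next
    show "Measurable.pred \<Omega> (\<lambda>X. short_child (swap_labels i j X) i j \<and> has_later (swap_labels i j X) j j)"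
      using measurable_compose[OF swap_labels_measurable, of i j "\<lambda>X. short_child X i j \<and> has_later X j j" "count_space UNIV"] assms
      by simp
  qed
  also have "\<dots> = pr (\<lambda>X. short_child X i j \<and> has_later X j j)"
    using assms by (intro pr_swap_labels) auto
  finally show ?thesis .
qed

lemma short_child_par: "short_child X i j \<Longrightarrow> par X j = i"
  by (intro par_eqI) (auto simp: short_child_def)

lemma short_child_unique: "short_child X i j \<Longrightarrow> short_child X i' j \<Longrightarrow> i = i'"
  using short_child_par by metis

lemma pr_disjoint_sum:
  assumes "finite A" "\<And>a. a \<in> A \<Longrightarrow> Measurable.pred \<Omega> (P a)"
    and "\<And>X a b. a \<in> A \<Longrightarrow> b \<in> A \<Longrightarrow> P a X \<Longrightarrow> P b X \<Longrightarrow> a = b"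
  shows "(\<Sum>a\<in>A. pr (P a)) = pr (\<lambda>X. \<exists>a\<in>A. P a X)"
proof -
  have "prob (\<Union>a\<in>A. {X \<in> space \<Omega>. P a X}) = (\<Sum>a\<in>A. pr (P a))"
  proof (rule finite_measure_finite_Union[OF assms(1)])
    show "disjoint_family_on (\<lambda>a. {X \<in> space \<Omega>. P a X}) A"
      using assms(3) by (force simp: disjoint_family_on_def)
  qed (use assms in auto)
  moreover have "(\<Union>a\<in>A. {X \<in> space \<Omega>. P a X}) = {X \<in> space \<Omega>. \<exists>a\<in>A. P a X}"
    by auto
  ultimately show ?thesis by simp
qed

lemma pr_split:
  assumes [measurable]: "Measurable.pred \<Omega> P" "Measurable.pred \<Omega> Q"
  shows "pr P = pr (\<lambda>X. P X \<and> Q X) + pr (\<lambda>X. P X \<and> \<not> Q X)"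
proof -
  have "prob ({X \<in> space \<Omega>. P X \<and> Q X} \<union> {X \<in> space \<Omega>. P X \<and> \<not> Q X}) = pr (\<lambda>X. P X \<and> Q X) + pr (\<lambda>X. P X \<and> \<not> Q X)"
    by (rule finite_measure_Union) auto
  moreover have "{X \<in> space \<Omega>. P X \<and> Q X} \<union> {X \<in> space \<Omega>. P X \<and> \<not> Q X} = {X \<in> space \<Omega>. P X}"
    by auto
  ultimately show ?thesis by simp
qed

text \<open>Without ties, a vertex with some elder nearer than \<open>s / 8\<close> is a short child
  of its parent. What remains is a null event and the event that all elders avoid a ball of radius
  \<open>s / 8\<close>.\<close>

lemma no_short_parent_prob:
  assumes "j < n"
  shows "pr (\<lambda>X. \<not> (\<exists>i<j. short_child X i j)) \<le> (1 - (1 / (8 * CARD('d))) ^ CARD('d)) ^ j"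
proof -
  have "pr (\<lambda>X. \<not> (\<exists>i<j. short_child X i j)) \<le>
    prob ({X \<in> space \<Omega>. \<forall>l<j. s / 8 \<le> D X j l} \<union> {X \<in> space \<Omega>. \<exists>a<j. \<exists>b<j. a \<noteq> b \<and> D X j a = D X j b})"
  proof (rule finite_measure_mono)
    show "{X \<in> space \<Omega>. \<not> (\<exists>i<j. short_child X i j)} \<subseteq>
      {X \<in> space \<Omega>. \<forall>l<j. s / 8 \<le> D X j l} \<union> {X \<in> space \<Omega>. \<exists>a<j. \<exists>b<j. a \<noteq> b \<and> D X j a = D X j b}"
    proof (rule subsetI, rule ccontr)
      fix X assume X: "X \<in> {X \<in> space \<Omega>. \<not> (\<exists>i<j. short_child X i j)}"
        and "X \<notin> {X \<in> space \<Omega>. \<forall>l<j. s / 8 \<le> D X j l} \<union> {X \<in> space \<Omega>. \<exists>a<j. \<exists>b<j. a \<noteq> b \<and> D X j a = D X j b}"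
      then obtain l where l: "l < j" "D X j l < s / 8"
        and tie: "\<And>a b. a < j \<Longrightarrow> b < j \<Longrightarrow> a \<noteq> b \<Longrightarrow> D X j a \<noteq> D X j b"
        by (auto simp: not_le)
      then have "j > 0" by simp
      have "D X j (par X j) < s / 8"
        using par_props(2)[where X=X, OF \<open>j > 0\<close> l(1)] l(2) by simp
      moreover have "D X j (par X j) < D X j m" if "m < j" "m \<noteq> par X j" for m
        using par_props(1,2)[where X=X, OF \<open>j > 0\<close>] tie[of "par X j" m] that by (metis order_le_less)
      ultimately have "short_child X (par X j) j"
        using par_props(1)[OF \<open>j > 0\<close>, of X] by (simp add: short_child_def)
      then show False
        using X par_props(1)[OF \<open>j > 0\<close>, of X] by auto
    qed
  qed measurable
  also have "\<dots> \<le> pr (\<lambda>X. \<forall>l<j. s / 8 \<le> D X j l) + pr (\<lambda>X. \<exists>a<j. \<exists>b<j. a \<noteq> b \<and> D X j a = D X j b)"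
    by (rule measure_Un_le) measurable
  also have "pr (\<lambda>X. \<forall>l<j. s / 8 \<le> D X j l) \<le> (1 - (s / 8 / (CARD('d) * s)) ^ CARD('d)) ^ j"
    using s_pos assms by (intro far_prob) auto
  also have "s / 8 / (CARD('d) * s) = 1 / (8 * CARD('d))"
    using s_pos by simp
  finally show ?thesis
    using tie_prob[OF assms] by simp
qed

lemma expectation_count:
  assumes "finite A" "\<And>a. a \<in> A \<Longrightarrow> Measurable.pred \<Omega> (P a)"
  shows "(\<integral>X. (\<Sum>a\<in>A. of_bool (P a X)) \<partial>\<Omega>) = (\<Sum>a\<in>A. pr (P a))"
    "integrable \<Omega> (\<lambda>X. (\<Sum>a\<in>A. of_bool (P a X)) :: real)"
proof -
  have i: "integrable \<Omega> (\<lambda>X. of_bool (P a X) :: real)" "(\<integral>X. of_bool (P a X) \<partial>\<Omega>) = pr (P a)" if "a \<in> A" for a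
  proof -
    have eq: "of_bool (P a X) = indicator {X \<in> space \<Omega>. P a X} X" if "X \<in> space \<Omega>" for X :: "nat \<Rightarrow> real^'d"
      using that by simp
    have m: "{X \<in> space \<Omega>. P a X} \<in> sets \<Omega>"
      using assms(2)[OF that] by measurable
    have "integrable \<Omega> (indicator {X \<in> space \<Omega>. P a X} :: _ \<Rightarrow> real)"
      using m by (intro integrable_const_bound[where B=1]) auto
    then show "integrable \<Omega> (\<lambda>X. of_bool (P a X) :: real)"
      using eq by (subst Bochner_Integration.integrable_cong[OF refl]) auto
    have "(\<integral>X. of_bool (P a X) \<partial>\<Omega>) = (\<integral>X. indicator {X \<in> space \<Omega>. P a X} X \<partial>\<Omega>)"
      using eq by (intro Bochner_Integration.integral_cong) auto
    also have "\<dots> = pr (P a)"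
      using m by (simp add: Int_absorb1)
    finally show "(\<integral>X. of_bool (P a X) \<partial>\<Omega>) = pr (P a)" .
  qed
  then show "(\<integral>X. (\<Sum>a\<in>A. of_bool (P a X)) \<partial>\<Omega>) = (\<Sum>a\<in>A. pr (P a))"
    by (subst Bochner_Integration.integral_sum) auto
  show "integrable \<Omega> (\<lambda>X. (\<Sum>a\<in>A. of_bool (P a X)) :: real)"
    using i by (intro Bochner_Integration.integrable_sum) auto
qed

lemma integrable_childless: "integrable \<Omega> (\<lambda>X. real (childless X))"
  by (rule integrable_const_bound[where B=n]) (auto simp: childless_le)

lemma childless_le_short: "real (childless X) \<le> (\<Sum>v<n. of_bool (\<not> has_later X v v))"
proof -
  have "children X v \<noteq> {}" if "has_later X v v" for v
    using that short_child_par by (fastforce simp: has_later_def children_def)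
  then show ?thesis
    unfolding childless_sum by (intro sum_mono) auto
qed

text \<open>Each vertex that has a short child is counted by its last one.\<close>

lemma last_child_count:
  "(\<Sum>j<n. \<Sum>i<j. of_bool (short_child X i j \<and> \<not> has_later X i j) :: real) \<le> (\<Sum>v<n. of_bool (has_later X v v))"
proof -
  have "(\<Sum>j<n. \<Sum>i<j. of_bool (short_child X i j \<and> \<not> has_later X i j) :: real)
    = (\<Sum>j<n. \<Sum>i<n. of_bool (short_child X i j \<and> \<not> has_later X i j))"
    by (intro sum.cong sum.mono_neutral_left refl) (auto simp: short_child_def)
  also have "\<dots> = (\<Sum>i<n. \<Sum>j<n. of_bool (short_child X i j \<and> \<not> has_later X i j))"
    by (rule sum.swap)
  also have "\<dots> \<le> (\<Sum>v<n. of_bool (has_later X v v))"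
  proof (rule sum_mono)
    fix i assume "i \<in> {..<n}"
    define J where "J = {j \<in> {..<n}. short_child X i j \<and> \<not> has_later X i j}"
    have "(\<Sum>j<n. of_bool (short_child X i j \<and> \<not> has_later X i j) :: real) = real (card J)"
      unfolding J_def of_bool_def sum.inter_filter[OF finite_lessThan, symmetric] by simp
    also have "card J \<le> of_bool (has_later X i i)"
    proof (cases "J = {}")
      case False
      then obtain j where j: "j \<in> J" by blast
      have "has_later X i i"
        using j by (auto simp: J_def has_later_def short_child_def)
      moreover have "J = {j}"
      proof -
        have "k = j" if "k \<in> J" for k
          using that j by (auto simp: J_def has_later_def) (metis linorder_neqE_nat)
        then show ?thesis using j by blast
      qed
      ultimately show ?thesis by simp
    qed simp
    then have "real (card J) \<le> of_bool (has_later X i i)"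
      by (simp add: of_bool_def split: if_splits)
    finally show "(\<Sum>j<n. of_bool (short_child X i j \<and> \<not> has_later X i j)) \<le> (of_bool (has_later X i i) :: real)" .
  qed
  finally show ?thesis .
qed

text \<open>Let \<open>a\<close> and \<open>b\<close> be the mean numbers of vertices without and
  with a short child. Then \<open>a + b = n\<close>, and the reflection argument gives
  \<open>a \<le> b + 1 / c\<close>, hence \<open>2 * a \<le> n + 1 / c\<close>. A childless vertex
  has no short child, so \<open>a\<close> bounds the mean in question.\<close>

lemma expectation_childless_upper:
  "(\<integral>X. real (childless X) \<partial>\<Omega>) \<le> real n / 2 + (8 * CARD('d)) ^ CARD('d) / 2"
proof -
  \<comment> \<open>A lower bound for the fraction of the torus covered by a ball of radius
    \<open>s / 8\<close>.\<close>
  define c where "c = (1 / (8 * real CARD('d))) ^ CARD('d)"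
  define a where "a = (\<Sum>v<n. pr (\<lambda>X. \<not> has_later X v v))"
  define b where "b = (\<Sum>v<n. pr (\<lambda>X. has_later X v v))"
  have "1 \<le> real CARD('d)"
    by (simp add: Suc_le_eq)
  then have "1 \<le> 8 * real CARD('d)"
    by linarith
  then have "1 / (8 * real CARD('d)) \<le> 1"
    by (subst divide_le_eq_1_pos) linarith+
  then have "c \<le> 1"
    unfolding c_def by (rule power_le_one[rotated]) simp
  moreover have "0 < c"
    by (simp add: c_def)
  ultimately have c: "0 < c" "c \<le> 1"
    by simp_all
  have ab: "a + b = real n"
  proof -
    have "pr (\<lambda>X. \<not> has_later X v v) + pr (\<lambda>X. has_later X v v) = 1" for v
      using pr_split[of "\<lambda>X. True" "\<lambda>X. has_later X v v"] prob_space by simp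
    then show ?thesis
      by (simp add: a_def b_def sum.distrib[symmetric])
  qed
  \<comment> \<open>When \<open>j\<close> is a short child of \<open>i\<close>,
    \<open>later_child_prob\<close> compares complements: \<open>j\<close> being the last short
    child of \<open>i\<close> is at least as likely as \<open>j\<close> having none itself.
    Summation over \<open>i\<close> loses the probability that \<open>j\<close> is nobody's short
    child.\<close>
  have step: "(\<Sum>i<j. pr (\<lambda>X. short_child X i j \<and> \<not> has_later X i j)) \<ge> pr (\<lambda>X. \<not> has_later X j j) - (1 - c) ^ j"
    if j: "j < n" for j
  proof -
    have "pr (\<lambda>X. short_child X i j \<and> \<not> has_later X j j) \<le> pr (\<lambda>X. short_child X i j \<and> \<not> has_later X i j)" if "i < j" for i
      using later_child_prob[OF that j] pr_split[of "\<lambda>X. short_child X i j" "\<lambda>X. has_later X i j"]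
        pr_split[of "\<lambda>X. short_child X i j" "\<lambda>X. has_later X j j"] by simp
    then have "(\<Sum>i<j. pr (\<lambda>X. short_child X i j \<and> \<not> has_later X i j)) \<ge> (\<Sum>i<j. pr (\<lambda>X. short_child X i j \<and> \<not> has_later X j j))"
      by (intro sum_mono) auto
    also have "(\<Sum>i<j. pr (\<lambda>X. short_child X i j \<and> \<not> has_later X j j)) = pr (\<lambda>X. \<exists>i\<in>{..<j}. short_child X i j \<and> \<not> has_later X j j)"
      by (rule pr_disjoint_sum) (auto dest: short_child_unique)
    also have "\<dots> = pr (\<lambda>X. \<not> has_later X j j \<and> (\<exists>i<j. short_child X i j))"
      by (intro arg_cong[where f=prob]) auto
    also have "\<dots> = pr (\<lambda>X. \<not> has_later X j j) - pr (\<lambda>X. \<not> has_later X j j \<and> \<not> (\<exists>i<j. short_child X i j))"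
      using pr_split[of "\<lambda>X. \<not> has_later X j j" "\<lambda>X. \<exists>i<j. short_child X i j"] by simp
    finally have *: "pr (\<lambda>X. \<not> has_later X j j) - pr (\<lambda>X. \<not> has_later X j j \<and> \<not> (\<exists>i<j. short_child X i j))
      \<le> (\<Sum>i<j. pr (\<lambda>X. short_child X i j \<and> \<not> has_later X i j))" .
    have "pr (\<lambda>X. \<not> has_later X j j \<and> \<not> (\<exists>i<j. short_child X i j)) \<le> pr (\<lambda>X. \<not> (\<exists>i<j. short_child X i j))"
      by (rule pr_mono) auto
    also have "\<dots> \<le> (1 - c) ^ j"
      using no_short_parent_prob[OF j] by (simp add: c_def)
    finally show ?thesis using * by simp
  qed
  have "(\<Sum>j<n. pr (\<lambda>X. \<not> has_later X j j) - (1 - c) ^ j) \<le> (\<Sum>j<n. \<Sum>i<j. pr (\<lambda>X. short_child X i j \<and> \<not> has_later X i j))"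
    using step by (intro sum_mono) auto
  also have "\<dots> = (\<integral>X. (\<Sum>j<n. \<Sum>i<j. of_bool (short_child X i j \<and> \<not> has_later X i j)) \<partial>\<Omega>)"
  proof (subst Bochner_Integration.integral_sum)
    show "integrable \<Omega> (\<lambda>X. \<Sum>i<j. of_bool (short_child X i j \<and> \<not> has_later X i j) :: real)" for j
      by (rule expectation_count(2)) measurable
    have "(\<Sum>i<j. pr (\<lambda>X. short_child X i j \<and> \<not> has_later X i j))
      = (\<integral>X. (\<Sum>i<j. of_bool (short_child X i j \<and> \<not> has_later X i j)) \<partial>\<Omega>)" for j
      by (rule expectation_count(1)[symmetric]) measurable
    then show "(\<Sum>j<n. \<Sum>i<j. pr (\<lambda>X. short_child X i j \<and> \<not> has_later X i j))
      = (\<Sum>j<n. \<integral>X. (\<Sum>i<j. of_bool (short_child X i j \<and> \<not> has_later X i j)) \<partial>\<Omega>)"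
      by (intro sum.cong refl)
  qed
  also have "\<dots> \<le> (\<integral>X. (\<Sum>v<n. of_bool (has_later X v v)) \<partial>\<Omega>)"
    by (intro integral_mono last_child_count Bochner_Integration.integrable_sum expectation_count(2)) auto
  also have "\<dots> = b"
    unfolding b_def by (rule expectation_count) auto
  finally have "a - (\<Sum>j<n. (1 - c) ^ j) \<le> b"
    by (simp add: a_def sum_subtractf)
  moreover have "(\<Sum>j<n. (1 - c) ^ j) \<le> 1 / c"
    using c by (rule geometric_sum_le)
  moreover have "1 / c = (8 * CARD('d)) ^ CARD('d)"
    by (simp add: c_def power_divide)
  ultimately have "2 * a \<le> real n + (8 * CARD('d)) ^ CARD('d)"
    using ab by simp
  moreover have "(\<integral>X. real (childless X) \<partial>\<Omega>) \<le> (\<integral>X. (\<Sum>v<n. of_bool (\<not> has_later X v v)) \<partial>\<Omega>)"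
    by (intro integral_mono childless_le_short integrable_childless expectation_count(2)) auto
  then have "(\<integral>X. real (childless X) \<partial>\<Omega>) \<le> a"
    unfolding a_def by (subst (asm) expectation_count) auto
  ultimately show ?thesis by simp
qed

subsection \<open>The lower bound on the expectation and the variance\<close>

lemma par_prob:
  assumes "i < k" "k < n"
  shows "pr (\<lambda>X. par X k = i) \<le> 1 / (real i + 1)"
proof -
  have "pr (\<lambda>X. par X k = i) \<le> pr (\<lambda>X. \<forall>l<i. D X k i < D X k l)"
    using assms par_props(3)[of k] by (intro pr_mono) auto
  also have "\<dots> \<le> 1 / (real i + 1)"
    using assms by (rule record_prob)
  finally show ?thesis .
qed

text \<open>Among the last \<open>n - m\<close> vertices, the number with children is at most the
  number of pairs \<open>m \<le> v < k < n\<close> in which \<open>k\<close> is a child of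
  \<open>v\<close>. There are at most (n - m)^2 such pairs, each of probability at most
  \<open>1 / (m + 1)\<close>.\<close>

lemma expectation_childless_lower:
  assumes "m \<le> n"
  shows "(real n - real m) - (real n - real m)\<^sup>2 / (real m + 1) \<le> (\<integral>X. real (childless X) \<partial>\<Omega>)"
proof -
  define A where "A = Sigma {m..<n} (\<lambda>v. {v<..<n})"
  have A: "finite A" "card A \<le> (n - m)\<^sup>2"
  proof -
    have "A \<subseteq> {m..<n} \<times> {m..<n}"
      by (auto simp: A_def)
    then show "finite A" "card A \<le> (n - m)\<^sup>2"
      using card_mono[of "{m..<n} \<times> {m..<n}" A] by (auto intro: finite_subset simp: power2_eq_square)
  qed
  have "(real n - real m) - (\<Sum>vk\<in>A. of_bool (par X (snd vk) = fst vk)) \<le> real (childless X)" for X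
  proof -
    have 1: "1 - (\<Sum>k\<in>{v<..<n}. of_bool (par X k = v)) \<le> (of_bool (children X v = {}) :: real)" for v
    proof (cases "children X v = {}")
      case True
      then show ?thesis by (simp add: sum_nonneg)
    next
      case False
      then obtain k where k: "k \<in> {v<..<n}" "par X k = v"
        by (auto simp: children_def)
      have "(\<Sum>k\<in>{v<..<n}. of_bool (par X k = v)) \<ge> (of_bool (par X k = v) :: real)"
        using k by (intro member_le_sum) auto
      then show ?thesis using k False by simp
    qed
    have "(real n - real m) - (\<Sum>vk\<in>A. of_bool (par X (snd vk) = fst vk))
      = (\<Sum>v\<in>{m..<n}. 1 - (\<Sum>k\<in>{v<..<n}. of_bool (par X k = v)))"
      unfolding A_def using assms by (simp add: sum.Sigma sum_subtractf case_prod_unfold del: sum_of_bool_eq)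
    also have "\<dots> \<le> (\<Sum>v\<in>{m..<n}. of_bool (children X v = {}))"
      by (intro sum_mono 1)
    also have "\<dots> \<le> (\<Sum>v<n. of_bool (children X v = {}))"
      by (intro sum_mono2) auto
    finally show ?thesis
      by (simp only: childless_sum)
  qed
  note pointwise = this
  have int: "integrable \<Omega> (\<lambda>X. \<Sum>vk\<in>A. of_bool (par X (snd vk) = fst vk) :: real)"
    by (rule expectation_count(2)[OF A(1)]) measurable
  have "(\<integral>X. (real n - real m) - (\<Sum>vk\<in>A. of_bool (par X (snd vk) = fst vk)) \<partial>\<Omega>) \<le> (\<integral>X. real (childless X) \<partial>\<Omega>)"
    by (intro integral_mono pointwise integrable_childless Bochner_Integration.integrable_diff int integrable_const)
  also have "(\<integral>X. (real n - real m) - (\<Sum>vk\<in>A. of_bool (par X (snd vk) = fst vk)) \<partial>\<Omega>)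
    = (real n - real m) - (\<integral>X. (\<Sum>vk\<in>A. of_bool (par X (snd vk) = fst vk)) \<partial>\<Omega>)"
    using int by (subst Bochner_Integration.integral_diff) (simp_all add: prob_space del: sum_of_bool_eq)
  also have "(\<integral>X. (\<Sum>vk\<in>A. of_bool (par X (snd vk) = fst vk)) \<partial>\<Omega>) = (\<Sum>vk\<in>A. pr (\<lambda>X. par X (snd vk) = fst vk))"
    by (rule expectation_count(1)[OF A(1)]) measurable
  finally have main: "(real n - real m) - (\<Sum>vk\<in>A. pr (\<lambda>X. par X (snd vk) = fst vk)) \<le> (\<integral>X. real (childless X) \<partial>\<Omega>)" .
  have "(\<Sum>vk\<in>A. pr (\<lambda>X. par X (snd vk) = fst vk)) \<le> (\<Sum>vk\<in>A. 1 / (real m + 1))"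
  proof (rule sum_mono)
    fix vk assume "vk \<in> A"
    then have v: "m \<le> fst vk" "fst vk < snd vk" "snd vk < n"
      by (auto simp: A_def)
    then have "pr (\<lambda>X. par X (snd vk) = fst vk) \<le> 1 / (real (fst vk) + 1)"
      by (intro par_prob)
    also have "\<dots> \<le> 1 / (real m + 1)"
      using v by (intro divide_left_mono) auto
    finally show "pr (\<lambda>X. par X (snd vk) = fst vk) \<le> 1 / (real m + 1)" .
  qed
  also have "\<dots> = real (card A) / (real m + 1)"
    by simp
  also have "\<dots> \<le> (real n - real m)\<^sup>2 / (real m + 1)"
  proof (rule divide_right_mono)
    have "real (card A) \<le> real ((n - m)\<^sup>2)"
      using A(2) by (rule of_nat_mono)
    then show "real (card A) \<le> (real n - real m)\<^sup>2"
      using assms by (simp add: of_nat_diff)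
  qed simp
  finally show ?thesis
    using main by simp
qed

section \<open>Second moments of the numbers of children, and the variance\<close>

definition far_parent :: "real \<Rightarrow> nat \<Rightarrow> nat \<Rightarrow> (nat \<Rightarrow> real^'d) \<Rightarrow> bool" where
  "far_parent \<rho> i j X \<longleftrightarrow> i < j \<and> par X j = i \<and> (\<forall>l<j. \<rho> \<le> D X j l)"

lemma far_parent_measurable [measurable]: "Measurable.pred \<Omega> (far_parent \<rho> i j)"
  unfolding far_parent_def by measurable

text \<open>If \<open>j\<close> is within \<open>\<rho>\<close> of \<open>i\<close>, the event for
  \<open>k\<close> is relaxed to a record of \<open>i\<close>, which is independent of that
  nearness. Otherwise all elders of \<open>j\<close> are at distance at least \<open>\<rho>\<close>,
  which is exponentially unlikely in \<open>j\<close>.\<close>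

lemma sibling_prob:
  assumes "i < j" "j < k" "k < n" "0 < \<rho>"
  shows "pr (\<lambda>X. par X j = i \<and> par X k = i) \<le> (2 * \<rho> / s) ^ CARD('d) / (real i + 1) + pr (far_parent \<rho> i j)"
proof -
  have "pr (\<lambda>X. par X j = i \<and> par X k = i) \<le>
    prob ({X \<in> space \<Omega>. (\<forall>l<i. D X k i < D X k l) \<and> D X j i < \<rho>} \<union> {X \<in> space \<Omega>. far_parent \<rho> i j X})"
  proof (rule finite_measure_mono)
    show "{X \<in> space \<Omega>. par X j = i \<and> par X k = i} \<subseteq>
      {X \<in> space \<Omega>. (\<forall>l<i. D X k i < D X k l) \<and> D X j i < \<rho>} \<union> {X \<in> space \<Omega>. far_parent \<rho> i j X}"
    proof
      fix X assume "X \<in> {X \<in> space \<Omega>. par X j = i \<and> par X k = i}"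
      then have X: "X \<in> space \<Omega>" "par X j = i" "par X k = i"
        by auto
      have "\<forall>l<i. D X k i < D X k l"
        using par_props(3)[of k _ X] X assms by auto
      moreover have "far_parent \<rho> i j X" if "\<not> D X j i < \<rho>"
        using par_props(2)[of j _ X] X assms that by (force simp: far_parent_def)
      ultimately show "X \<in> {X \<in> space \<Omega>. (\<forall>l<i. D X k i < D X k l) \<and> D X j i < \<rho>} \<union> {X \<in> space \<Omega>. far_parent \<rho> i j X}"
        using X(1) by blast
    qed
  qed measurable
  also have "\<dots> \<le> pr (\<lambda>X. (\<forall>l<i. D X k i < D X k l) \<and> D X j i < \<rho>) + pr (far_parent \<rho> i j)"
    by (rule measure_Un_le) measurable
  also have "pr (\<lambda>X. (\<forall>l<i. D X k i < D X k l) \<and> D X j i < \<rho>) \<le> (2 * \<rho> / s) ^ CARD('d) * pr (\<lambda>X. \<forall>l<i. D X k i < D X k l)"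
    using assms by (intro near_prob) auto
  also have "\<dots> \<le> (2 * \<rho> / s) ^ CARD('d) * (1 / (real i + 1))"
    using assms s_pos by (intro mult_left_mono record_prob) auto
  finally show ?thesis by simp
qed

text \<open>The square counts ordered pairs of children. For each pair the near part of the sibling
  bound sums over \<open>i\<close> to a harmonic number. Every far event enters \<open>2 * n\<close>
  times, and their probabilities add up to at most \<open>1 / c\<close>. The diagonal gives at most
  \<open>n\<close>, one parent per vertex.\<close>

lemma children_second_moment:
  assumes "0 < \<rho>" "\<rho> \<le> s / 2"
  shows "(\<Sum>i<n. \<integral>X. (real (card (children X i)))\<^sup>2 \<partial>\<Omega>)
    \<le> (real n)\<^sup>2 * (2 * \<rho> / s) ^ CARD('d) * (\<Sum>i<n. 1 / (real i + 1))
      + 2 * real n * (CARD('d) * s / \<rho>) ^ CARD('d) + real n"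
proof -
  define q where "q = (2 * \<rho> / s) ^ CARD('d)"
  define c where "c = (\<rho> / (CARD('d) * s)) ^ CARD('d)"
  define t where "t i j k = pr (\<lambda>X. (i < j \<and> par X j = i) \<and> (i < k \<and> par X k = i))" for i j k
  define u where "u i j = pr (far_parent \<rho> i j)" for i j
  define v where "v i j = pr (\<lambda>X. i < j \<and> par X j = i)" for i j
  have q: "0 \<le> q"
    using assms s_pos by (simp add: q_def)
  have u: "0 \<le> u i j" and v: "0 \<le> v i j" for i j
    by (simp_all add: u_def v_def)
  have sq: "(\<integral>X. (real (card (children X i)))\<^sup>2 \<partial>\<Omega>) = (\<Sum>j<n. \<Sum>k<n. t i j k)" for i
  proof -
    have "(real (card (children X i)))\<^sup>2 = (\<Sum>jk\<in>{..<n}\<times>{..<n}. of_bool ((i < fst jk \<and> par X (fst jk) = i) \<and> (i < snd jk \<and> par X (snd jk) = i)))" for X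
    proof -
      have "real (card (children X i)) = (\<Sum>k<n. of_bool (i < k \<and> par X k = i))"
        unfolding children_card of_nat_sum by (intro sum.cong) auto
      then have "(real (card (children X i)))\<^sup>2 = (\<Sum>j<n. \<Sum>k<n. of_bool (i < j \<and> par X j = i) * of_bool (i < k \<and> par X k = i))"
        unfolding power2_eq_square by (simp only: sum_product)
      also have "\<dots> = (\<Sum>jk\<in>{..<n}\<times>{..<n}. of_bool (i < fst jk \<and> par X (fst jk) = i) * of_bool (i < snd jk \<and> par X (snd jk) = i))"
        by (simp only: sum.cartesian_product case_prod_unfold)
      also have "\<dots> = (\<Sum>jk\<in>{..<n}\<times>{..<n}. of_bool ((i < fst jk \<and> par X (fst jk) = i) \<and> (i < snd jk \<and> par X (snd jk) = i)))"
        by (intro sum.cong refl) (simp only: of_bool_conj)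
      finally show ?thesis .
    qed
    then have "(\<integral>X. (real (card (children X i)))\<^sup>2 \<partial>\<Omega>) =
      (\<integral>X. (\<Sum>jk\<in>{..<n}\<times>{..<n}. of_bool ((i < fst jk \<and> par X (fst jk) = i) \<and> (i < snd jk \<and> par X (snd jk) = i))) \<partial>\<Omega>)"
      by (simp only:)
    also have "\<dots> = (\<Sum>jk\<in>{..<n}\<times>{..<n}. t i (fst jk) (snd jk))"
      unfolding t_def by (rule expectation_count(1)) (simp, measurable)
    also have "\<dots> = (\<Sum>j<n. \<Sum>k<n. t i j k)"
      by (simp only: sum.cartesian_product case_prod_unfold)
    finally show ?thesis .
  qed
  \<comment> \<open>The far event of \<open>sibling_prob\<close> concerns the earlier of the two
    siblings; including both terms makes the bound independent of the order of \<open>j\<close> and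
    \<open>k\<close>.\<close>
  have le: "t i j k \<le> q / (real i + 1) + u i j + u i k + of_bool (j = k) * v i j" if "j < n" "k < n" for i j k
  proof -
    have nn: "0 \<le> q / (real i + 1)" using q by simp
    have sib: "t i j k \<le> q / (real i + 1) + u i j" if "j < k" "k < n" for j k
    proof (cases "i < j")
      case True
      have "t i j k \<le> pr (\<lambda>X. par X j = i \<and> par X k = i)"
        unfolding t_def by (rule pr_mono) auto
      also have "\<dots> \<le> q / (real i + 1) + u i j"
        unfolding q_def u_def using True that assms(1) by (rule sibling_prob)
      finally show ?thesis .
    next
      case False
      then show ?thesis using nn u by (simp add: t_def)
    qed
    consider "j < k" | "k < j" | "j = k" by linarith
    then show ?thesis
    proof cases
      case 1
      then show ?thesis using sib[of j k] u[of i k] that by simp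
    next
      case 2
      have "t i j k = t i k j"
        unfolding t_def by (intro arg_cong[where f=prob]) auto
      then show ?thesis using sib[of k j] u[of i j] 2 that by simp
    next
      case 3
      have "t i j j = v i j"
        unfolding t_def v_def by simp
      then show ?thesis using 3 nn u[of i j] by simp
    qed
  qed
  \<comment> \<open>For fixed \<open>j\<close> these events are disjoint, as \<open>j\<close> has
    one parent. This is why \<open>far_parent\<close> records \<open>i\<close>.\<close>
  have usum: "(\<Sum>i<n. u i j) \<le> (1 - c) ^ j" if "j < n" for j
  proof -
    have "(\<Sum>i<n. u i j) = pr (\<lambda>X. \<exists>i\<in>{..<n}. far_parent \<rho> i j X)"
      unfolding u_def by (rule pr_disjoint_sum) (auto simp: far_parent_def)
    also have "\<dots> \<le> pr (\<lambda>X. \<forall>l<j. \<rho> \<le> D X j l)"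
      by (rule pr_mono) (auto simp: far_parent_def)
    also have "\<dots> \<le> (1 - c) ^ j"
      unfolding c_def using that assms by (rule far_prob)
    finally show ?thesis .
  qed
  have vsum: "(\<Sum>i<n. v i j) \<le> 1" if "j < n" for j
  proof -
    have "(\<Sum>i<n. v i j) = pr (\<lambda>X. \<exists>i\<in>{..<n}. i < j \<and> par X j = i)"
      unfolding v_def by (rule pr_disjoint_sum) auto
    then show ?thesis by simp
  qed
  have c: "0 < c" "c \<le> 1"
  proof -
    show "0 < c" using assms s_pos by (simp add: c_def)
    have "1 \<le> real CARD('d)"
      by (simp add: Suc_le_eq)
    then have "1 * s \<le> real CARD('d) * s"
      using s_pos by (intro mult_right_mono) auto
    then have "\<rho> \<le> real CARD('d) * s"
      using assms s_pos by linarith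
    then have "\<rho> / (real CARD('d) * s) \<le> 1"
      using s_pos by (subst divide_le_eq_1_pos) auto
    then show "c \<le> 1"
      unfolding c_def using assms s_pos by (intro power_le_one) auto
  qed
  have U: "(\<Sum>i<n. \<Sum>j<n. u i j) \<le> 1 / c"
  proof -
    have "(\<Sum>i<n. \<Sum>j<n. u i j) = (\<Sum>j<n. \<Sum>i<n. u i j)"
      by (rule sum.swap)
    also have "\<dots> \<le> (\<Sum>j<n. (1 - c) ^ j)"
      using usum by (intro sum_mono) auto
    finally show ?thesis using geometric_sum_le[OF c, of n] by linarith
  qed
  have V: "(\<Sum>i<n. \<Sum>j<n. v i j) \<le> real n"
  proof -
    have "(\<Sum>i<n. \<Sum>j<n. v i j) = (\<Sum>j<n. \<Sum>i<n. v i j)"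
      by (rule sum.swap)
    also have "\<dots> \<le> (\<Sum>j<n. 1)"
      using vsum by (intro sum_mono) auto
    finally show ?thesis by simp
  qed
  have "(\<Sum>i<n. \<integral>X. (real (card (children X i)))\<^sup>2 \<partial>\<Omega>) = (\<Sum>i<n. \<Sum>j<n. \<Sum>k<n. t i j k)"
    by (simp only: sq)
  also have "\<dots> \<le> (\<Sum>i<n. \<Sum>j<n. \<Sum>k<n. q / (real i + 1) + u i j + u i k + of_bool (j = k) * v i j)"
    using le by (intro sum_mono) auto
  also have "\<dots> = (\<Sum>i<n. (real n)\<^sup>2 * (q / (real i + 1)) + 2 * real n * (\<Sum>j<n. u i j) + (\<Sum>j<n. v i j))"
  proof (rule sum.cong[OF refl])
    fix i
    have "(\<Sum>k<n. of_bool (j = k) * v i j) = v i j" if "j < n" for j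
      using that by (simp add: of_bool_def if_distrib[of "\<lambda>x. x * _"] cong: if_cong)
    then have "(\<Sum>j<n. \<Sum>k<n. of_bool (j = k) * v i j) = (\<Sum>j<n. v i j)"
      by (intro sum.cong) auto
    then show "(\<Sum>j<n. \<Sum>k<n. q / (real i + 1) + u i j + u i k + of_bool (j = k) * v i j)
      = (real n)\<^sup>2 * (q / (real i + 1)) + 2 * real n * (\<Sum>j<n. u i j) + (\<Sum>j<n. v i j)"
      by (simp only: sum.distrib sum_constant card_lessThan sum_distrib_left[symmetric])
        (simp add: power2_eq_square)
  qed
  also have "\<dots> = (real n)\<^sup>2 * q * (\<Sum>i<n. 1 / (real i + 1)) + 2 * real n * (\<Sum>i<n. \<Sum>j<n. u i j) + (\<Sum>i<n. \<Sum>j<n. v i j)"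
    by (simp add: sum.distrib sum_distrib_left mult.assoc)
  also have "\<dots> \<le> (real n)\<^sup>2 * q * (\<Sum>i<n. 1 / (real i + 1)) + 2 * real n * (1 / c) + real n"
    using U V by (intro add_mono mult_left_mono order_refl) auto
  also have "1 / c = (CARD('d) * s / \<rho>) ^ CARD('d)"
    by (simp add: c_def power_divide)
  finally show ?thesis
    by (simp add: q_def)
qed

text \<open>With \<open>a\<close> and \<open>b\<close> the numbers of children before and after the
  move, the change is at most \<open>1 + a + b\<close>. The moved configuration has the same law, so
  both squares have equal means and each Efron--Stein term is at most 3 + 6 E[a^2]. The linear term
  collects \<open>3 / 2 * n\<close> from this and \<open>3 * n\<close> from the diagonal of the
  second moment.\<close>

lemma variance_childless:
  assumes "0 < \<rho>" "\<rho> \<le> s / 2"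
  shows "variance (\<lambda>X. real (childless X))
    \<le> 9 / 2 * real n + 3 * ((real n)\<^sup>2 * (2 * \<rho> / s) ^ CARD('d) * (\<Sum>i<n. 1 / (real i + 1))
      + 2 * real n * (CARD('d) * s / \<rho>) ^ CARD('d))"
proof -
  interpret N: prob_space N by (rule prob_space_N)
  define F where "F X = real (childless X)" for X
  define C where "C i X = (real (card (children X i)))\<^sup>2" for i X
  have F_m [measurable]: "F \<in> borel_measurable \<Omega>"
    unfolding F_def by measurable
  have C_m [measurable]: "C i \<in> borel_measurable \<Omega>" for i
    unfolding C_def by measurable
  have Fb: "\<bar>F X\<bar> \<le> real n" for X
    by (simp add: F_def childless_le)
  have Cb: "\<bar>C i X\<bar> \<le> (real n)\<^sup>2" for i X
    by (simp add: C_def children_le power_mono)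
  have upd: "(\<lambda>w. (fst w)(i := snd w)) \<in> measurable (\<Omega> \<Otimes>\<^sub>M N) \<Omega>" if "i < n" for i
    using that by (intro fun_upd_measurable) auto
  have iC: "integrable \<Omega> (C i)" for i
    using Cb by (intro integrable_const_bound[where B="(real n)\<^sup>2"]) auto
  have one: "(\<integral>X. \<integral>z. (F X - F (X(i := z)))\<^sup>2 \<partial>N \<partial>\<Omega>) \<le> 3 + 6 * (\<integral>X. C i X \<partial>\<Omega>)" if i: "i < n" for i
  proof -
    have m1 [measurable]: "(\<lambda>w. F ((fst w)(i := snd w))) \<in> borel_measurable (\<Omega> \<Otimes>\<^sub>M N)"
      and m2 [measurable]: "(\<lambda>w. C i ((fst w)(i := snd w))) \<in> borel_measurable (\<Omega> \<Otimes>\<^sub>M N)"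
      by (rule measurable_compose[OF upd[OF i] F_m], rule measurable_compose[OF upd[OF i] C_m])
    have u1 [measurable]: "(\<lambda>z. F (X(i := z))) \<in> borel_measurable N" "(\<lambda>z. C i (X(i := z))) \<in> borel_measurable N" if "X \<in> space \<Omega>" for X
      using measurable_compose[OF measurable_Pair1'[OF that] m1] measurable_compose[OF measurable_Pair1'[OF that] m2] by auto
    have bd: "\<bar>(F X - F Y)\<^sup>2\<bar> \<le> (real n)\<^sup>2" for X Y
    proof -
      have "\<bar>F X - F Y\<bar> \<le> \<bar>real n\<bar>"
        using childless_le[of X] childless_le[of Y] by (simp add: F_def)
      then show ?thesis by (simp only: abs_le_square_iff abs_power2)
    qed
    have pw: "(F X - F (X(i := z)))\<^sup>2 \<le> 3 + 3 * C i X + 3 * C i (X(i := z))" for X z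
    proof -
      define a where "a = real (card (children X i))"
      define b where "b = real (card (children (X(i := z)) i))"
      have "\<bar>F X - F (X(i := z))\<bar> \<le> \<bar>1 + a + b\<bar>"
        using childless_upd[of X i z] by (simp add: F_def a_def b_def)
      then have "(F X - F (X(i := z)))\<^sup>2 \<le> (1 + a + b)\<^sup>2"
        by (simp only: abs_le_square_iff)
      \<comment> \<open>The right-hand side exceeds the left-hand side by exactly the sum of the
        three squares below.\<close>
      also have "\<dots> \<le> 3 + 3 * a\<^sup>2 + 3 * b\<^sup>2"
        using zero_le_power2[of "1 - a"] zero_le_power2[of "1 - b"] zero_le_power2[of "a - b"]
        by (simp add: power2_eq_square algebra_simps)
      finally show ?thesis by (simp add: C_def a_def b_def)
    qed
    have iz: "integrable N (\<lambda>z. C i (X(i := z)))" if "X \<in> space \<Omega>" for X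
      using Cb u1[OF that] by (intro N.integrable_const_bound[where B="(real n)\<^sup>2"]) auto
    have iX: "integrable \<Omega> (\<lambda>X. \<integral>z. C i (X(i := z)) \<partial>N)"
    proof (rule integrable_const_bound[where B="(real n)\<^sup>2"])
      show "AE X in \<Omega>. norm (\<integral>z. C i (X(i := z)) \<partial>N) \<le> (real n)\<^sup>2"
        using N.abs_expectation_le[OF Cb] by simp
    qed measurable
    have "(\<integral>X. \<integral>z. (F X - F (X(i := z)))\<^sup>2 \<partial>N \<partial>\<Omega>) \<le> (\<integral>X. 3 + 3 * C i X + 3 * (\<integral>z. C i (X(i := z)) \<partial>N) \<partial>\<Omega>)"
    proof (rule integral_mono)
      show "integrable \<Omega> (\<lambda>X. \<integral>z. (F X - F (X(i := z)))\<^sup>2 \<partial>N)"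
      proof (rule integrable_const_bound[where B="(real n)\<^sup>2"])
        have "\<bar>\<integral>z. (F X - F (X(i := z)))\<^sup>2 \<partial>N\<bar> \<le> (real n)\<^sup>2" for X
          by (rule N.abs_expectation_le) (rule bd)
        then show "AE X in \<Omega>. norm (\<integral>z. (F X - F (X(i := z)))\<^sup>2 \<partial>N) \<le> (real n)\<^sup>2"
          by (intro AE_I2) (simp only: real_norm_def)
      qed measurable
      show "integrable \<Omega> (\<lambda>X. 3 + 3 * C i X + 3 * (\<integral>z. C i (X(i := z)) \<partial>N))"
        using iC iX by auto
      fix X assume X: "X \<in> space \<Omega>"
      have "(\<integral>z. (F X - F (X(i := z)))\<^sup>2 \<partial>N) \<le> (\<integral>z. 3 + 3 * C i X + 3 * C i (X(i := z)) \<partial>N)"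
      proof (rule integral_mono)
        show "integrable N (\<lambda>z. (F X - F (X(i := z)))\<^sup>2)"
          using bd u1[OF X] by (intro N.integrable_const_bound[where B="(real n)\<^sup>2"] AE_I2) auto
        show "integrable N (\<lambda>z. 3 + 3 * C i X + 3 * C i (X(i := z)))"
          using iz[OF X] by simp
      qed (rule pw)
      also have "\<dots> = 3 + 3 * C i X + 3 * (\<integral>z. C i (X(i := z)) \<partial>N)"
        using iz[OF X] N.prob_space by simp
      finally show "(\<integral>z. (F X - F (X(i := z)))\<^sup>2 \<partial>N) \<le> 3 + 3 * C i X + 3 * (\<integral>z. C i (X(i := z)) \<partial>N)" .
    qed
    also have "\<dots> = 3 + 3 * (\<integral>X. C i X \<partial>\<Omega>) + 3 * (\<integral>X. \<integral>z. C i (X(i := z)) \<partial>N \<partial>\<Omega>)"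
      using iC iX by (simp add: prob_space)
    also have "(\<integral>X. \<integral>z. C i (X(i := z)) \<partial>N \<partial>\<Omega>) = (\<integral>X. C i X \<partial>\<Omega>)"
      using i Cb by (intro integral_PiM_resample[where B="(real n)\<^sup>2"] prob_space_N) auto
    finally show ?thesis by linarith
  qed
  have "integrable \<Omega> (\<lambda>X. (F X)\<^sup>2)"
  proof (rule integrable_const_bound[where B="(real n)\<^sup>2"])
    have "\<bar>(F X)\<^sup>2\<bar> \<le> (real n)\<^sup>2" for X
      by (simp add: F_def childless_le power_mono)
    then show "AE X in \<Omega>. norm ((F X)\<^sup>2) \<le> (real n)\<^sup>2"
      by (intro AE_I2) (simp only: real_norm_def)
  qed measurable
  then have "variance F = (\<integral>X. (F X)\<^sup>2 \<partial>\<Omega>) - (\<integral>X. F X \<partial>\<Omega>)\<^sup>2"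
    using integrable_childless by (intro variance_eq) (simp_all add: F_def)
  also have "\<dots> \<le> (1 / 2) * (\<Sum>i<n. \<integral>X. \<integral>z. (F X - F (X(i := z)))\<^sup>2 \<partial>N \<partial>\<Omega>)"
    by (rule efron_stein[OF prob_space_N _ F_m Fb]) simp
  also have "\<dots> \<le> (1 / 2) * (\<Sum>i<n. 3 + 6 * (\<integral>X. C i X \<partial>\<Omega>))"
    using one by (intro mult_left_mono sum_mono) auto
  also have "\<dots> = 3 / 2 * real n + 3 * (\<Sum>i<n. \<integral>X. C i X \<partial>\<Omega>)"
    by (simp add: sum.distrib sum_distrib_left[symmetric] distrib_left)
  finally show ?thesis
    using children_second_moment[OF assms] unfolding F_def C_def by (simp add: distrib_left)
qed

section \<open>From childless vertices to leaves, and concentration\<close>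

definition leaves :: "(nat \<Rightarrow> real^'d) \<Rightarrow> nat" where
  "leaves X = card {v. v < n \<and> of_bool (1 \<le> v) + card (children X v) = 1}"

text \<open>Every vertex except \<open>0\<close> has an edge to its parent and so is a leaf exactly
  when it is childless. Only the status of vertex \<open>0\<close> can differ.\<close>

lemma leaves_childless: "\<bar>real (leaves X) - real (childless X)\<bar> \<le> 1"
proof -
  define A where "A = {v. v < n \<and> of_bool (1 \<le> v) + card (children X v) = 1}"
  define B where "B = {v. v < n \<and> children X v = {}}"
  have fin: "finite A" "finite B"
    by (simp_all add: A_def B_def)
  have "A - {0} = B - {0}"
    by (auto simp: A_def B_def)
  then have "A \<subseteq> insert 0 B" "B \<subseteq> insert 0 A"
    by auto
  then have "card A \<le> card (insert 0 B)" "card B \<le> card (insert 0 A)"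
    using fin by (auto intro!: card_mono)
  then have "card A \<le> card B + 1" "card B \<le> card A + 1"
    using card_insert_le_m1 fin by (auto simp: card_insert_if split: if_splits)
  then show ?thesis
    unfolding leaves_def childless_def A_def[symmetric] B_def[symmetric] by linarith
qed

lemma leaves_measurable [measurable]: "(\<lambda>X. real (leaves X)) \<in> borel_measurable \<Omega>"
proof -
  have "real (leaves X) = (\<Sum>v<n. if real (of_bool (1 \<le> v)) + real (card (children X v)) = 1 then 1 else 0)" for X
  proof -
    have "{v. v < n \<and> of_bool (1 \<le> v) + card (children X v) = 1} = {v \<in> {..<n}. real (of_bool (1 \<le> v)) + real (card (children X v)) = 1}"
      by (auto simp: of_nat_add[symmetric] simp del: of_nat_add of_nat_of_bool)
    then show ?thesis
      unfolding leaves_def by (simp add: sum.inter_filter[symmetric])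
  qed
  then show ?thesis
    by simp
qed

text \<open>An edge determines its younger endpoint, since parents are strictly older: two distinct
  vertices with the same edge would each be the parent of the other. So the edges can be counted by
  their younger endpoints, which at \<open>v\<close> are \<open>v\<close> itself, unless
  \<open>v = 0\<close>, and its children.\<close>

lemma edge_card: "card {e \<in> {{k, par X k} | k. 1 \<le> k \<and> k < n}. v \<in> e} = of_bool (1 \<le> v \<and> v < n) + card (children X v)"
proof -
  define A where "A = {k. 1 \<le> k \<and> k < n \<and> v \<in> {k, par X k}}"
  have lt: "par X k < k" if "1 \<le> k" for k
    using par_props(1)[of k X] that by simp
  have "{e \<in> {{k, par X k} | k. 1 \<le> k \<and> k < n}. v \<in> e} = (\<lambda>k. {k, par X k}) ` A"
    by (auto simp: A_def)
  moreover have "inj_on (\<lambda>k. {k, par X k}) A"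
  proof (rule inj_onI)
    fix k l assume "k \<in> A" "l \<in> A" "{k, par X k} = {l, par X l}"
    then show "k = l"
      using lt[of k] lt[of l] by (auto simp: A_def doubleton_eq_iff)
  qed
  ultimately have "card {e \<in> {{k, par X k} | k. 1 \<le> k \<and> k < n}. v \<in> e} = card A"
    by (simp add: card_image)
  also have "A = {k. k = v \<and> 1 \<le> v \<and> v < n} \<union> children X v"
    using lt by (fastforce simp: A_def children_def)
  also have "card \<dots> = card {k. k = v \<and> 1 \<le> v \<and> v < n} + card (children X v)"
    by (rule card_Un_disjoint) (auto simp: children_def)
  also have "card {k. k = v \<and> 1 \<le> v \<and> v < n} = of_bool (1 \<le> v \<and> v < n)"
    by (cases "1 \<le> v \<and> v < n") auto
  finally show ?thesis .
qed

text \<open>Chebyshev's inequality with deviation n^(7/8). The bound on the variance is of order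
  n^(3/2) ln n, so the bound on the probability is of order n^(-1/4) ln n.\<close>

lemma childless_concentration:
  assumes n: "n \<ge> 1"
  shows "pr (\<lambda>X. n powr (- 1 / 8) * n \<le> \<bar>real (childless X) - (\<integral>X. real (childless X) \<partial>\<Omega>)\<bar>)
    \<le> (9 / 2 * real n + 3 * ((real n)\<^sup>2 / sqrt n * (ln n + 1) + 2 * real n * ((2 * CARD('d)) ^ CARD('d) * sqrt n)))
        / (n powr (- 1 / 8) * n)\<^sup>2"
proof -
  \<comment> \<open>The radius is chosen so that
    \<open>(2 * \<rho> / s) ^ CARD('d) = 1 / sqrt n\<close>. This makes the near and the far term of
    the variance both of order n^(3/2), up to a logarithm.\<close>
  define lam where "lam = root CARD('d) (1 / sqrt n)"
  have lam: "0 < lam" "lam \<le> 1" "lam ^ CARD('d) = 1 / sqrt n"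
    using n by (simp_all add: lam_def)
  define \<rho> where "\<rho> = s * lam / 2"
  have \<rho>: "0 < \<rho>" "\<rho> \<le> s / 2"
    using lam s_pos by (simp_all add: \<rho>_def)
  have 1: "(2 * \<rho> / s) ^ CARD('d) = 1 / sqrt n"
    using s_pos lam(3) by (simp add: \<rho>_def)
  have "CARD('d) * s / \<rho> = 2 * CARD('d) / lam"
    using s_pos by (simp add: \<rho>_def)
  then have 2: "(CARD('d) * s / \<rho>) ^ CARD('d) = (2 * CARD('d)) ^ CARD('d) * sqrt n"
    using lam(3) by (simp add: power_divide)
  have "variance (\<lambda>X. real (childless X))
    \<le> 9 / 2 * real n + 3 * ((real n)\<^sup>2 * (1 / sqrt n) * (\<Sum>i<n. 1 / (real i + 1))
      + 2 * real n * ((2 * CARD('d)) ^ CARD('d) * sqrt n))"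
    using variance_childless[OF \<rho>] unfolding 1 2 .
  also have "\<dots> \<le> 9 / 2 * real n + 3 * ((real n)\<^sup>2 * (1 / sqrt n) * (ln n + 1)
      + 2 * real n * ((2 * CARD('d)) ^ CARD('d) * sqrt n))"
    using harmonic_le_ln[OF n] by (intro add_mono mult_left_mono order_refl) auto
  finally have v: "variance (\<lambda>X. real (childless X)) \<le> 9 / 2 * real n + 3 * ((real n)\<^sup>2 / sqrt n * (ln n + 1)
      + 2 * real n * ((2 * CARD('d)) ^ CARD('d) * sqrt n))"
    by simp
  have "integrable \<Omega> (\<lambda>X. (real (childless X))\<^sup>2)"
  proof (rule integrable_const_bound[where B="(real n)\<^sup>2"])
    show "AE X in \<Omega>. norm ((real (childless X))\<^sup>2) \<le> (real n)\<^sup>2"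
      by (simp add: childless_le power_mono)
  qed measurable
  then have "pr (\<lambda>X. n powr (- 1 / 8) * n \<le> \<bar>real (childless X) - (\<integral>X. real (childless X) \<partial>\<Omega>)\<bar>)
    \<le> variance (\<lambda>X. real (childless X)) / (n powr (- 1 / 8) * n)\<^sup>2"
    using n by (intro Chebyshev_inequality) auto
  also have "\<dots> \<le> (9 / 2 * real n + 3 * ((real n)\<^sup>2 / sqrt n * (ln n + 1) + 2 * real n * ((2 * CARD('d)) ^ CARD('d) * sqrt n)))
        / (n powr (- 1 / 8) * n)\<^sup>2"
    by (rule divide_right_mono[OF v]) simp
  finally show ?thesis .
qed

text \<open>Applying the bound to the last quarter of the vertices gives the coefficient 1/4 -
  (1/4)^2 / (3/4) = 1/6; the additive constant \<open>2\<close> absorbs the rounding.\<close>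

lemma expectation_childless_sixth:
  assumes n: "n \<ge> 1"
  shows "real n / 6 - 2 \<le> (\<integral>X. real (childless X) \<partial>\<Omega>)"
proof -
  define m where "m = 3 * n div 4"
  have m: "m \<le> n" "3 * n < 4 * m + 4" "4 * m \<le> 3 * n"
    by (auto simp: m_def)
  define x where "x = real n - real m"
  have x: "real n / 4 \<le> x" "x \<le> real n / 4 + 1" "3 / 4 * real n \<le> real m + 1"
    using m by (auto simp: x_def)
  have "x\<^sup>2 \<le> (real n / 4 + 1)\<^sup>2"
    using x by (intro power_mono) auto
  then have "x\<^sup>2 / (real m + 1) \<le> (real n / 4 + 1)\<^sup>2 / (3 / 4 * real n)"
    using x n by (intro frac_le) auto
  also have "\<dots> = real n / 12 + 2 / 3 + 4 / (3 * real n)"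
    using n by (simp add: power2_eq_square field_simps)
  also have "\<dots> \<le> real n / 12 + 2"
    using n by (simp add: field_simps)
  finally have "real n / 6 - 2 \<le> x - x\<^sup>2 / (real m + 1)"
    using x by simp
  also have "\<dots> \<le> (\<integral>X. real (childless X) \<partial>\<Omega>)"
    unfolding x_def by (rule expectation_childless_lower[OF m(1)])
  finally show ?thesis .
qed

lemma leaves_bounds:
  assumes n: "n \<ge> 1"
  defines "\<epsilon> \<equiv> n powr (- 1 / 8) + ((8 * CARD('d)) ^ CARD('d) + 4) / n"
  shows "1 - (9 / 2 * real n + 3 * ((real n)\<^sup>2 / sqrt n * (ln n + 1) + 2 * real n * ((2 * CARD('d)) ^ CARD('d) * sqrt n)))
        / (n powr (- 1 / 8) * n)\<^sup>2
    \<le> pr (\<lambda>X. (1 / (4 * exp 1 ^ 4) - \<epsilon>) * real n \<le> real (leaves X) \<and> real (leaves X) \<le> (1 / 2 + \<epsilon>) * real n)"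
proof -
  define \<delta> where "\<delta> = n powr (- 1 / 8) * n"
  define \<mu> where "\<mu> = (\<integral>X. real (childless X) \<partial>\<Omega>)"
  define K where "K = real ((8 * CARD('d)) ^ CARD('d))"
  have K: "0 \<le> K" by (simp add: K_def)
  \<comment> \<open>\<open>\<delta>\<close> is the fluctuation, \<open>K\<close> covers the excess
    of the mean over \<open>n / 2\<close>, and \<open>4\<close> covers both the \<open>2\<close> in
    the lower bound on the mean and the difference of at most \<open>1\<close> between leaves and
    childless vertices.\<close>
  have \<epsilon>: "\<epsilon> * real n = \<delta> + K + 4"
    using n by (simp add: \<epsilon>_def \<delta>_def K_def field_simps)
  have \<mu>: "\<mu> \<le> real n / 2 + K / 2" "real n / 6 - 2 \<le> \<mu>"
    using expectation_childless_upper expectation_childless_sixth[OF n] by (simp_all add: \<mu>_def K_def)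
  \<comment> \<open>A crude bound on e is enough, because the mean is at least n/6 up to a constant
    and \<open>4 * 2 ^ 4 \<ge> 6\<close>.\<close>
  have "(2::real) \<le> exp 1"
    using exp_ge_add_one_self[of 1] by simp
  then have "(2::real) ^ 4 \<le> exp 1 ^ 4"
    by (intro power_mono) auto
  then have "1 / (4 * exp 1 ^ 4 :: real) \<le> 1 / 6"
    by (intro divide_left_mono) auto
  then have e: "1 / (4 * exp 1 ^ 4) * real n \<le> 1 / 6 * real n"
    by (rule mult_right_mono) simp
  have "1 - pr (\<lambda>X. \<delta> \<le> \<bar>real (childless X) - \<mu>\<bar>) = prob (space \<Omega> - {X \<in> space \<Omega>. \<delta> \<le> \<bar>real (childless X) - \<mu>\<bar>})"
    by (rule prob_compl[symmetric]) measurable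
  also have "\<dots> \<le> pr (\<lambda>X. (1 / (4 * exp 1 ^ 4) - \<epsilon>) * real n \<le> real (leaves X) \<and> real (leaves X) \<le> (1 / 2 + \<epsilon>) * real n)"
  proof (rule finite_measure_mono)
    show "space \<Omega> - {X \<in> space \<Omega>. \<delta> \<le> \<bar>real (childless X) - \<mu>\<bar>} \<subseteq>
      {X \<in> space \<Omega>. (1 / (4 * exp 1 ^ 4) - \<epsilon>) * real n \<le> real (leaves X) \<and> real (leaves X) \<le> (1 / 2 + \<epsilon>) * real n}"
    proof
      fix X assume "X \<in> space \<Omega> - {X \<in> space \<Omega>. \<delta> \<le> \<bar>real (childless X) - \<mu>\<bar>}"
      then have X: "X \<in> space \<Omega>" "\<bar>real (childless X) - \<mu>\<bar> < \<delta>"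
        by auto
      have "real (leaves X) \<le> real n / 2 + (\<delta> + K + 4)"
        using X(2) leaves_childless[of X] \<mu>(1) K by linarith
      moreover have "1 / (4 * exp 1 ^ 4) * real n - (\<delta> + K + 4) \<le> real (leaves X)"
        using X(2) leaves_childless[of X] \<mu>(2) K e by linarith
      ultimately show "X \<in> {X \<in> space \<Omega>. (1 / (4 * exp 1 ^ 4) - \<epsilon>) * real n \<le> real (leaves X) \<and> real (leaves X) \<le> (1 / 2 + \<epsilon>) * real n}"
        using X(1) \<epsilon> by (simp add: algebra_simps)
    qed
  qed measurable
  finally show ?thesis
    using childless_concentration[OF n] unfolding \<delta>_def \<mu>_def by linarith
qed

end

section \<open>Identification with the stated model, and the limit\<close>

lemma nn_space_torus_sample:
  assumes "n \<ge> 1"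
  shows "nn_space n = (PiM {..<n} (\<lambda>_. torus_unif (root CARD('d) (real n)) 0) :: (nat \<Rightarrow> real^'d) measure)"
    and "nn_leaves n (x :: nat \<Rightarrow> real^'d) = torus_sample.leaves (root CARD('d) (real n)) n x"
proof -
  define s where "s = root CARD('d) (real n)"
  interpret torus_sample s n "TYPE('d)"
    by unfold_locales (use assms in \<open>simp add: s_def\<close>)
  have "fundamental_domain n = (half_open_box s 0 :: (real^'d) set)"
    by (simp add: fundamental_domain_def half_open_box_def s_def)
  then show "nn_space n = (PiM {..<n} (\<lambda>_. torus_unif (root CARD('d) (real n)) 0) :: (nat \<Rightarrow> real^'d) measure)"
    by (simp add: nn_space_def torus_unif_def s_def)
  have "torus_dist n y z = torus_norm s (y - z)" for y z :: "real^'d"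
    by (simp add: torus_dist_eq[OF assms] s_def)
  \<comment> \<open>Both sides break ties by the same \<open>LEAST\<close>, so the parent maps agree
    at every sample point, not only almost surely.\<close>
  then have par: "nn_parent n x = par x"
    by (simp add: fun_eq_iff nn_parent_def par_def D_def)
  have "nn_degree n x v = of_bool (1 \<le> v) + card (children x v)" if "v < n" for v
    unfolding nn_degree_def nn_edges_def par edge_card using that by simp
  then have "nn_leaves n x = leaves x"
    unfolding nn_leaves_def leaves_def by (intro arg_cong[where f=card]) auto
  then show "nn_leaves n x = torus_sample.leaves (root CARD('d) (real n)) n x"
    by (simp add: s_def)
qed

theorem theorem1p10:
  "\<exists>\<epsilon> :: nat \<Rightarrow> real. \<epsilon> \<longlonglongrightarrow> 0 \<and>
     (\<lambda>n. \<P>(x in (nn_space n :: (nat \<Rightarrow> real^'d) measure).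
        (1 / (4 * exp 1 ^ 4) - \<epsilon> n) * real n \<le> real (nn_leaves n x) \<and>
        real (nn_leaves n x) \<le> (1 / 2 + \<epsilon> n) * real n)) \<longlonglongrightarrow> 1"
proof -
  define \<epsilon> :: "nat \<Rightarrow> real" where "\<epsilon> n = n powr (- 1 / 8) + ((8 * CARD('d)) ^ CARD('d) + 4) / n" for n
  define K where "K = real ((2 * CARD('d)) ^ CARD('d))"
  define \<eta> :: "nat \<Rightarrow> real" where "\<eta> n = (9 / 2 * real n + 3 * ((real n)\<^sup>2 / sqrt n * (ln n + 1) + 2 * real n * (K * sqrt n)))
        / (n powr (- 1 / 8) * n)\<^sup>2" for n
  define p where "p n = \<P>(x in (nn_space n :: (nat \<Rightarrow> real^'d) measure).
        (1 / (4 * exp 1 ^ 4) - \<epsilon> n) * real n \<le> real (nn_leaves n x) \<and>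
        real (nn_leaves n x) \<le> (1 / 2 + \<epsilon> n) * real n)" for n
  \<comment> \<open>For \<open>n = 0\<close> the torus would have side \<open>0\<close>; the limits
    need the bounds only from \<open>n = 1\<close> on.\<close>
  have bounds: "1 - \<eta> n \<le> p n \<and> p n \<le> 1" if n: "n \<ge> 1" for n
  proof -
    interpret torus_sample "root CARD('d) (real n)" n "TYPE('d)"
      by unfold_locales (use n in simp)
    have "p n = pr (\<lambda>X. (1 / (4 * exp 1 ^ 4) - \<epsilon> n) * real n \<le> real (leaves X) \<and> real (leaves X) \<le> (1 / 2 + \<epsilon> n) * real n)"
      unfolding p_def nn_space_torus_sample[OF n] by simp
    then show ?thesis
      using leaves_bounds[OF n] by (simp add: \<epsilon>_def \<eta>_def K_def)
  qed
  have "\<epsilon> \<longlonglongrightarrow> 0"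
    unfolding \<epsilon>_def by real_asymp
  moreover have "(\<lambda>n. 1 - \<eta> n) \<longlonglongrightarrow> 1"
    unfolding \<eta>_def by real_asymp
  then have "p \<longlonglongrightarrow> 1"
    by (rule tendsto_sandwich[rotated 2, OF _ tendsto_const])
       (use bounds in \<open>auto intro!: eventually_sequentiallyI[of 1]\<close>)
  ultimately show ?thesis
    unfolding p_def by blast
qed

end
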